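(* Let $\mathcal{F}=(\mu_n,\mathcal{S}_n,K_n,\pi_n)_{n\ge1}$ be a family of irreducible, reversible discrete-time finite Markov chains with $\pi_n(|\mu_n/\pi_n|^2)\to\infty$. Let $\mathcal{F}_c$ be the family of associated continuous-time chains and, for $\theta\in(0,1)$, $\mathcal{F}_\theta$ the family of $\theta$-lazy chains, with $L^2$-mixing times $T^{(c)}_{n,2}(\mu_n,\cdot)$ and $T^{(\theta)}_{n,2}(\mu_n,\cdot)$. (1) If $\theta\in[1/2,1)$, $\mathcal{F}_\theta$ has an $L^2$-cutoff and $T^{(\theta)}_{n,2}(\mu_n,\epsilon_0)\to\infty$ for some $\epsilon_0>0$, then $\mathcal{F}_c$ has an $L^2$-cutoff. (2) If $\mathcal{F}_c$ has an $L^2$-cutoff and $T^{(c)}_{n,2}(\mu_n,\epsilon_0)\to\infty$ for some $\epsilon_0>0$, then $\mathcal{F}_\theta$ has an $L^2$-cutoff for all $\theta\in(1/2,1)$. Moreover, for $\theta\in(1/2,1)$, if both $\mathcal{F}_c$ and $\mathcal{F}_\theta$ have $L^2$-cutoffs and there is $\epsilon_0>0$ with $T^{(c)}_{n,2}(\mu_n,\epsilon_0)\to\infty$ or $T^{(\theta)}_{n,2}(\mu_n,\epsilon_0)\to\infty$, then for all $\epsilon>0$ \[1-\theta\le\liminf_n\frac{T^{(c)}_{n,2}(\mu_n,\epsilon)}{T^{(\theta)}_{n,2}(\mu_n,\epsilon)}\le\limsup_n\frac{T^{(c)}_{n,2}(\mu_n,\epsilon)}{T^{(\theta)}_{n,2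}(\mu_n,\epsilon)}\le\frac{-\log(2\theta-1)}{2}.\]
   Context: For a discrete-time chain $(\mathcal{S},K,\pi)$ and $\theta\in(0,1)$, its $\theta$-lazy version is the discrete-time chain with transition matrix $K_\theta=\theta I+(1-\theta)K$, and its associated continuous-time chain has generator $L=K-I$; both keep initial distribution $\mu_n$ and stationary distribution $\pi_n$. $L^2$-distance: continuous time $d_2(\mu,t)=\|\mu e^{tL}/\pi-1\|_{L^2(\pi)}$, discrete time $d_2(\mu,m)=\|\mu K^m/\pi-1\|_{L^2(\pi)}$; mixing time $T_2(\mu,\epsilon)=\min\{t\ge0:d_2(\mu,t)\le\epsilon\}$ (integer $t$ in discrete time); $\pi(|\mu/\pi|^2)=\sum_y\mu(y)^2/\pi(y)$. $L^2$-cutoff: there is $t_n>0$ with $d_{n,2}(\mu_n,(1+a)t_n)\to0$ and $d_{n,2}(\mu_n,(1-a)t_n)\to\infty$ for all $a\in(0,1)$ (in discrete time, with times $\lceil(1+a)t_n\rceil$ and $\lfloor(1-a)t_n\rfloor$). *)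

theory Defs
  imports "HOL-Analysis.Analysis"
begin

text \<open>A finite Markov chain is given by a finite state space S, a kernel K
(only its values on S x S matter), a stationary distribution pi and an
initial distribution mu.\<close>

fun mpow :: "'a set \<Rightarrow> ('a \<Rightarrow> 'a \<Rightarrow> real) \<Rightarrow> nat \<Rightarrow> 'a \<Rightarrow> 'a \<Rightarrow> real" where
  "mpow S K 0 x y = (if x = y then 1 else 0)"
| "mpow S K (Suc m) x y = (\<Sum>z\<in>S. mpow S K m x z * K z y)"

definition lazy_kernel :: "real \<Rightarrow> ('a \<Rightarrow> 'a \<Rightarrow> real) \<Rightarrow> 'a \<Rightarrow> 'a \<Rightarrow> real" where
  "lazy_kernel \<theta> K x y = \<theta> * (if x = y then 1 else 0) + (1 - \<theta>) * K x y"

text \<open>heat kernel e^{t(K - I)} = e^{-t} sum_k t^k/k! K^k\<close>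
definition heat :: "'a set \<Rightarrow> ('a \<Rightarrow> 'a \<Rightarrow> real) \<Rightarrow> real \<Rightarrow> 'a \<Rightarrow> 'a \<Rightarrow> real" where
  "heat S K t x y = (\<Sum>k. exp (- t) * t ^ k / fact k * mpow S K k x y)"

definition markov_chain :: "'a set \<Rightarrow> ('a \<Rightarrow> 'a \<Rightarrow> real) \<Rightarrow> bool" where
  "markov_chain S K \<longleftrightarrow> finite S \<and> S \<noteq> {} \<and>
     (\<forall>x\<in>S. \<forall>y\<in>S. K x y \<ge> 0) \<and> (\<forall>x\<in>S. (\<Sum>y\<in>S. K x y) = 1)"

definition irreducible_chain :: "'a set \<Rightarrow> ('a \<Rightarrow> 'a \<Rightarrow> real) \<Rightarrow> bool" where
  "irreducible_chain S K \<longleftrightarrow> (\<forall>x\<in>S. \<forall>y\<in>S. \<exists>m. mpow S K m x y > 0)"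

definition prob_dist :: "'a set \<Rightarrow> ('a \<Rightarrow> real) \<Rightarrow> bool" where
  "prob_dist S p \<longleftrightarrow> (\<forall>x\<in>S. p x \<ge> 0) \<and> (\<Sum>x\<in>S. p x) = 1"

text \<open>reversible w.r.t. the (positive) probability pi (which is then stationary)\<close>
definition reversible_chain :: "'a set \<Rightarrow> ('a \<Rightarrow> 'a \<Rightarrow> real) \<Rightarrow> ('a \<Rightarrow> real) \<Rightarrow> bool" where
  "reversible_chain S K \<pi> \<longleftrightarrow> prob_dist S \<pi> \<and> (\<forall>x\<in>S. \<pi> x > 0) \<and>
     (\<forall>x\<in>S. \<forall>y\<in>S. \<pi> x * K x y = \<pi> y * K y x)"

definition l2dist :: "'a set \<Rightarrow> ('a \<Rightarrow> real) \<Rightarrow> ('a \<Rightarrow> real) \<Rightarrow> real" where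
  "l2dist S \<pi> \<nu> = sqrt (\<Sum>y\<in>S. \<pi> y * (\<nu> y / \<pi> y - 1)\<^sup>2)"

definition d2_disc :: "'a set \<Rightarrow> ('a \<Rightarrow> 'a \<Rightarrow> real) \<Rightarrow> ('a \<Rightarrow> real) \<Rightarrow> ('a \<Rightarrow> real) \<Rightarrow> nat \<Rightarrow> real" where
  "d2_disc S K \<pi> \<mu> m = l2dist S \<pi> (\<lambda>y. \<Sum>x\<in>S. \<mu> x * mpow S K m x y)"

definition d2_cont :: "'a set \<Rightarrow> ('a \<Rightarrow> 'a \<Rightarrow> real) \<Rightarrow> ('a \<Rightarrow> real) \<Rightarrow> ('a \<Rightarrow> real) \<Rightarrow> real \<Rightarrow> real" where
  "d2_cont S K \<pi> \<mu> t = l2dist S \<pi> (\<lambda>y. \<Sum>x\<in>S. \<mu> x * heat S K t x y)"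

definition T2_disc :: "'a set \<Rightarrow> ('a \<Rightarrow> 'a \<Rightarrow> real) \<Rightarrow> ('a \<Rightarrow> real) \<Rightarrow> ('a \<Rightarrow> real) \<Rightarrow> real \<Rightarrow> nat" where
  "T2_disc S K \<pi> \<mu> \<epsilon> = (LEAST m. d2_disc S K \<pi> \<mu> m \<le> \<epsilon>)"

definition T2_cont :: "'a set \<Rightarrow> ('a \<Rightarrow> 'a \<Rightarrow> real) \<Rightarrow> ('a \<Rightarrow> real) \<Rightarrow> ('a \<Rightarrow> real) \<Rightarrow> real \<Rightarrow> real" where
  "T2_cont S K \<pi> \<mu> \<epsilon> = Inf {t. t \<ge> 0 \<and> d2_cont S K \<pi> \<mu> t \<le> \<epsilon>}"

definition cutoff_cont :: "(nat \<Rightarrow> 'a set) \<Rightarrow> (nat \<Rightarrow> 'a \<Rightarrow> 'a \<Rightarrow> real) \<Rightarrow> (nat \<Rightarrow> 'a \<Rightarrow> real) \<Rightarrow> (nat \<Rightarrow> 'a \<Rightarrow> real) \<Rightarrow> bool" where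
  "cutoff_cont S K \<pi> \<mu> \<longleftrightarrow> (\<exists>t::nat \<Rightarrow> real. (\<forall>n. t n > 0) \<and>
     (\<forall>a. 0 < a \<and> a < 1 \<longrightarrow>
        ((\<lambda>n. d2_cont (S n) (K n) (\<pi> n) (\<mu> n) ((1 + a) * t n)) \<longlonglongrightarrow> 0) \<and>
        filterlim (\<lambda>n. d2_cont (S n) (K n) (\<pi> n) (\<mu> n) ((1 - a) * t n)) at_top sequentially))"

definition cutoff_disc :: "(nat \<Rightarrow> 'a set) \<Rightarrow> (nat \<Rightarrow> 'a \<Rightarrow> 'a \<Rightarrow> real) \<Rightarrow> (nat \<Rightarrow> 'a \<Rightarrow> real) \<Rightarrow> (nat \<Rightarrow> 'a \<Rightarrow> real) \<Rightarrow> bool" where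
  "cutoff_disc S K \<pi> \<mu> \<longleftrightarrow> (\<exists>t::nat \<Rightarrow> real. (\<forall>n. t n > 0) \<and>
     (\<forall>a. 0 < a \<and> a < 1 \<longrightarrow>
        ((\<lambda>n. d2_disc (S n) (K n) (\<pi> n) (\<mu> n) (nat \<lceil>(1 + a) * t n\<rceil>)) \<longlonglongrightarrow> 0) \<and>
        filterlim (\<lambda>n. d2_disc (S n) (K n) (\<pi> n) (\<mu> n) (nat \<lfloor>(1 - a) * t n\<rfloor>)) at_top sequentially))"

end

theory Submission
  imports Defs "HOL-Computational_Algebra.Fundamental_Theorem_Algebra"
begin

text \<open>
  Reversibility gives weights \<open>w l \<ge> 0\<close> on finitely many spectral values \<open>0 < l \<le> 2\<close> of \<open>I - K\<close>
  such that the squared \<open>L\<^sup>2\<close>-distances are \<open>f(t) = \<Sum>l. w l * exp (- 2 t l)\<close> in continuous time and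
  \<open>g(m) = \<Sum>l. w l * (1 - (1 - \<theta>) l) ^ (2 m)\<close> for the lazy chain.
  If \<open>f(t) = 1\<close>, then \<open>f((1 + a) t)\<close> is the expectation of \<open>exp (- 2 a t l)\<close> under the
  probability weights \<open>w l * exp (- 2 t l)\<close>; so it tends to 0 iff for every \<open>M\<close> the mass of
  \<open>{l. l \<le> M / t}\<close> tends to 0, and log-convexity of \<open>f\<close> then forces \<open>f((1 - a) t)\<close> to infinity.
  The same criterion holds for \<open>g\<close>. With \<open>c = - ln (2 \<theta> - 1) / 2\<close>, concavity of the logarithm gives
  \<open>f(c m) \<le> g(m) \<le> f((1 - \<theta>) m)\<close>. Hence the two time scales are comparable, the criterion
  passes from one family to the other, and the mixing times compare with constants \<open>1 - \<theta>\<close> and \<open>c\<close>.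
  From \<open>g\<close> to \<open>f\<close> only the upper bound on \<open>g\<close> is needed, which is why \<open>\<theta> = 1/2\<close> is allowed there.
\<close>

subsection \<open>Positive functionals on polynomials\<close>

text \<open>Over the complex numbers the polynomial has a root; a real root gives the linear factor,
  a non-real one its real quadratic. The quadratic is displayed as a sum of squares so that
  positivity of a functional can be applied to it.\<close>

lemma real_poly_factor:
  fixes p :: "real poly"
  assumes "degree p > 0"
  obtains \<beta> q where "p = [:-\<beta>, 1:] * q"
  | a b q where "b \<noteq> 0" "p = ([:-a, 1:]\<^sup>2 + [:b\<^sup>2:]) * q"
proof -
  let ?P = "map_poly complex_of_real p"
  have "degree ?P > 0" using assms by (subst degree_map_poly) auto
  then have "\<not> constant (poly ?P)" by (simp add: constant_degree)
  then obtain z where z: "poly ?P z = 0" using fundamental_theorem_of_algebra by blast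
  have z2: "poly (map_poly complex_of_real q) (of_real x) = of_real (poly q x)" for q x
    by (induction q) (auto simp: map_poly_pCons)
  show ?thesis
  proof (cases "Im z = 0")
    case True
    then have "z = of_real (Re z)" by (simp add: complex_eq_iff)
    then have "poly p (Re z) = 0" using z z2[of p "Re z"] by simp
    then have "[:- Re z, 1:] dvd p" by (simp add: poly_eq_0_iff_dvd)
    then show ?thesis using that(1) by (metis dvdE)
  next
    case False
    define a b where "a = Re z" and "b = Im z"
    define Q where "Q = [:-a, 1:]\<^sup>2 + [:b\<^sup>2:]"
    have Q: "Q = [:a\<^sup>2 + b\<^sup>2, -2 * a, 1:]" by (simp add: Q_def power2_eq_square)
    have Qz: "poly (map_poly complex_of_real Q) z = 0"
      by (simp add: Q a_def b_def map_poly_pCons complex_eq_iff power2_eq_square algebra_simps)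
    have mult: "map_poly complex_of_real (p * q) = map_poly complex_of_real p * map_poly complex_of_real q" for p q
      by (rule poly_eqI) (simp add: coeff_map_poly coeff_mult)
    have add: "map_poly complex_of_real (p + q) = map_poly complex_of_real p + map_poly complex_of_real q" for p q
      by (rule poly_eqI) (simp add: coeff_map_poly)
    \<comment> \<open>The remainder modulo \<open>Q\<close> has degree at most 1 and vanishes at the
      non-real \<open>z\<close>. Imaginary and real part of \<open>c + d * z = 0\<close> then give
      \<open>d = 0\<close> and \<open>c = 0\<close>.\<close>
    have "p = Q * (p div Q) + p mod Q" by simp
    then have "?P = map_poly complex_of_real Q * map_poly complex_of_real (p div Q) + map_poly complex_of_real (p mod Q)"
      by (metis mult add)
    then have mz: "poly (map_poly complex_of_real (p mod Q)) z = 0" using z Qz by simp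
    have "p mod Q = 0 \<or> degree (p mod Q) < 2"
      using degree_mod_less[of Q p] Q by auto
    then have "degree (p mod Q) \<le> 1" by auto
    moreover obtain c r where r: "p mod Q = pCons c r" by (rule pCons_cases)
    ultimately have "degree r = 0" by (simp add: degree_pCons_eq_if split: if_splits)
    then obtain d where cd: "p mod Q = [:c, d:]" using r by (auto elim: degree_eq_zeroE)
    have "d * b = 0" "c + d * a = 0"
      using mz by (auto simp: cd map_poly_pCons complex_eq_iff a_def b_def algebra_simps)
    then have "p mod Q = 0" using False by (auto simp: cd b_def)
    then have "p = Q * (p div Q)" using \<open>p = Q * (p div Q) + p mod Q\<close> by simp
    then show ?thesis using that(2)[of b a "p div Q"] False by (simp add: Q_def b_def)
  qed
qed

text \<open>
  Induction on the degree of an annihilator \<open>p0\<close> of \<open>L\<close>. A non-real root would give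
  \<open>L (((X - a) q)\<^sup>2) + b\<^sup>2 L (q\<^sup>2) = 0\<close>, so that \<open>q\<close> is already an annihilator; at a real root \<open>\<beta>\<close>
  with cofactor \<open>q\<close>, subtracting the point mass \<open>L (q\<^sup>2) / q(\<beta>)\<^sup>2\<close> leaves a positive functional
  annihilated by \<open>q\<close>.
\<close>

lemma positive_functional_representation:
  fixes L :: "real poly \<Rightarrow> real"
  assumes add: "\<And>p q. L (p + q) = L p + L q" and smult: "\<And>c p. L (smult c p) = c * L p"
    and pos: "\<And>p. L (p * p) \<ge> 0" and "p0 \<noteq> 0" and "\<And>q. L (p0 * q) = 0"
  shows "\<exists>B w. finite B \<and> (\<forall>\<beta>\<in>B. 0 \<le> w \<beta>) \<and> (\<forall>q. L q = (\<Sum>\<beta>\<in>B. w \<beta> * poly q \<beta>))"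
  using assms
proof (induction "degree p0" arbitrary: p0 L rule: less_induct)
  case less
  note add = less.prems(1) and smult = less.prems(2) and pos = less.prems(3)
    and p0 = less.prems(4) and ann = less.prems(5)
  \<comment> \<open>Degenerate Cauchy-Schwarz: when \<open>L (q * q) = 0\<close>, the value of
    \<open>L\<close> on the square of \<open>s q + r\<close> is affine in \<open>s\<close>. The
    \<open>s\<close> below makes it equal to -1 if the slope is nonzero.\<close>
  have null: "L (q * r) = 0" if q: "L (q * q) = 0" for q r
  proof (rule ccontr)
    assume nz: "L (q * r) \<noteq> 0"
    define s where "s = - (L (r * r) + 1) / (2 * L (q * r))"
    have eq: "(smult s q + r) * (smult s q + r) = smult (s * s) (q * q) + ((smult s (q * r) + smult s (q * r)) + r * r)"
      by (simp only: distrib_left distrib_right mult_smult_left mult_smult_right smult_smult smult_add_right ac_simps)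
    have "0 \<le> s * s * L (q * q) + (s * L (q * r) + s * L (q * r) + L (r * r))"
      using pos[of "smult s q + r"] by (simp only: eq add smult)
    then show False using nz q by (simp add: s_def)
  qed
  show ?case
  proof (cases "degree p0 = 0")
    case True
    then obtain c where c: "p0 = [:c:]" by (rule degree_eq_zeroE)
    have "L q = 0" for q using ann[of q] p0 by (simp add: c smult)
    then show ?thesis by (intro exI[of _ "{}"]) auto
  next
    case False
    then have "degree p0 > 0" by simp
    then show ?thesis
    proof (cases rule: real_poly_factor)
      case (2 a b q)
      have q0: "q \<noteq> 0" using p0 2 by auto
      have "degree ([:-a, 1:]\<^sup>2 + [:b\<^sup>2:]) = 2" by (simp add: power2_eq_square)
      then have dq: "degree q < degree p0" using 2 q0 by (subst \<open>p0 = _\<close>, subst degree_mult_eq) auto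
      have "p0 * q = ([:-a, 1:] * q) * ([:-a, 1:] * q) + smult (b\<^sup>2) (q * q)"
      proof -
        have "(x\<^sup>2 + [:b\<^sup>2:]) * q * q = (x * q) * (x * q) + smult (b\<^sup>2) (q * q)" for x :: "real poly"
          by (simp add: algebra_simps power2_eq_square)
        then show ?thesis by (subst \<open>p0 = _\<close>)
      qed
      then have "L (([:-a, 1:] * q) * ([:-a, 1:] * q)) + b\<^sup>2 * L (q * q) = 0"
        using ann[of q] by (metis add smult)
      then have "b\<^sup>2 * L (q * q) = 0"
        using pos[of q] pos[of "[:-a, 1:] * q"] by (smt (verit) mult_nonneg_nonneg zero_le_power2)
      then have "L (q * q) = 0" using 2 by simp
      then show ?thesis using less.hyps[OF dq add smult pos q0] null by blast
    next
      case (1 \<beta> q)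
      have q0: "q \<noteq> 0" using p0 1 by auto
      have dq: "degree q < degree p0" using q0 by (subst \<open>p0 = _\<close>, subst degree_mult_eq) auto
      have root: "L (q * r) = 0" if "poly r \<beta> = 0" for r
      proof -
        obtain r' where "r = [:-\<beta>, 1:] * r'" using \<open>poly r \<beta> = 0\<close> by (metis dvdE poly_eq_0_iff_dvd)
        then have "q * r = p0 * r'" using 1 by (simp only: ac_simps)
        then show ?thesis using ann by simp
      qed
      show ?thesis
      proof (cases "poly q \<beta> = 0")
        case True
        \<comment> \<open>With \<open>r = q\<close>, \<open>root\<close> gives
          \<open>L (q * q) = 0\<close>, so by \<open>null\<close> the cofactor \<open>q\<close>
          already annihilates \<open>L\<close>.\<close>
        then show ?thesis using less.hyps[OF dq add smult pos q0] null root by blast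
      next
        case False
        define w0 where "w0 = L (q * q) / (poly q \<beta>)\<^sup>2"
        have w0: "w0 \<ge> 0" using pos by (simp add: w0_def)
        define L' where "L' = (\<lambda>r. L r - w0 * poly r \<beta>)"
        \<comment> \<open>Every \<open>r\<close> is a multiple of \<open>q\<close> plus some
          \<open>s\<close> vanishing at \<beta>, and \<open>root\<close> makes \<open>s\<close>
          orthogonal to \<open>q\<close> for \<open>L\<close>. Annihilation and positivity of
          \<open>L'\<close> are both read off from this orthogonal splitting.\<close>
        have dec: "\<exists>s. r = smult (poly r \<beta> / poly q \<beta>) q + s \<and> poly s \<beta> = 0" for r
          by (rule exI[of _ "r - smult (poly r \<beta> / poly q \<beta>) q"]) (use False in simp)
        have "L' (q * r) = 0" for r
        proof -
          obtain s where s: "r = smult (poly r \<beta> / poly q \<beta>) q + s" "poly s \<beta> = 0" using dec by blast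
          have "q * r = smult (poly r \<beta> / poly q \<beta>) (q * q) + q * s" by (subst s(1)) (simp add: algebra_simps)
          then have "L (q * r) = poly r \<beta> / poly q \<beta> * L (q * q)" using root[OF s(2)] by (simp add: add smult)
          then show ?thesis using False by (simp add: L'_def w0_def power2_eq_square)
        qed
        moreover have "L' (r * r) \<ge> 0" for r
        proof -
          obtain s where s: "r = smult (poly r \<beta> / poly q \<beta>) q + s" "poly s \<beta> = 0" using dec by blast
          define c where "c = poly r \<beta> / poly q \<beta>"
          have sq: "(smult c q + s) * (smult c q + s) = smult (c * c) (q * q) + ((smult c (q * s) + smult c (q * s)) + s * s)"
            by (simp only: distrib_left distrib_right mult_smult_left mult_smult_right smult_smult smult_add_right ac_simps)
          have "L (r * r) = L ((smult c q + s) * (smult c q + s))" using s(1) by (simp add: c_def)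
          then have "L (r * r) = c * c * L (q * q) + L (s * s)"
            using root[OF s(2)] by (simp only: sq add smult mult_zero_right add_0)
          moreover have "c * c * L (q * q) = w0 * poly (r * r) \<beta>"
            using False by (simp add: c_def w0_def power2_eq_square)
          ultimately show ?thesis using pos[of s] by (simp add: L'_def)
        qed
        moreover have "L' (p + r) = L' p + L' r" "L' (smult c p) = c * L' p" for p r c
          by (simp_all add: L'_def add smult algebra_simps)
        ultimately obtain B w where B: "finite B" "\<forall>\<beta>\<in>B. 0 \<le> w \<beta>" "\<And>q. L' q = (\<Sum>\<beta>\<in>B. w \<beta> * poly q \<beta>)"
          using less.hyps[OF dq, of L'] q0 by blast
        \<comment> \<open>The new atom may coincide with one already in \<open>B\<close>; in that
          case the masses add up.\<close>
        define w' where "w' = (\<lambda>x. (if x \<in> B then w x else 0) + (if x = \<beta> then w0 else 0))"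
        have "L r = (\<Sum>x\<in>insert \<beta> B. w' x * poly r x)" for r
        proof -
          have "(\<Sum>x\<in>insert \<beta> B. w' x * poly r x) =
            (\<Sum>x\<in>insert \<beta> B. if x \<in> B then w x * poly r x else 0) + (\<Sum>x\<in>insert \<beta> B. if x = \<beta> then w0 * poly r x else 0)"
            unfolding sum.distrib[symmetric] by (rule sum.cong) (auto simp: w'_def algebra_simps)
          also have "(\<Sum>x\<in>insert \<beta> B. if x \<in> B then w x * poly r x else 0) = (\<Sum>x\<in>B. w x * poly r x)"
            using B(1) by (intro sum.mono_neutral_cong_right) auto
          also have "(\<Sum>x\<in>insert \<beta> B. if x = \<beta> then w0 * poly r x else 0) = w0 * poly r \<beta>"
            using B(1) by simp
          finally show ?thesis using B(3)[of r] by (simp add: L'_def)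
        qed
        then show ?thesis using B w0 by (intro exI[of _ "insert \<beta> B"] exI[of _ w']) (auto simp: w'_def)
      qed
    qed
  qed
qed

subsection \<open>The spectral measure of a reversible chain\<close>

lemma mpow_nonneg:
  assumes "markov_chain S K" "x \<in> S" "y \<in> S"
  shows "mpow S K m x y \<ge> 0"
  using assms(3)
proof (induction m arbitrary: y)
  case (Suc m)
  then show ?case using assms(1) by (auto simp: markov_chain_def intro!: sum_nonneg mult_nonneg_nonneg)
qed auto

lemma mpow_row_sum:
  assumes "markov_chain S K" "x \<in> S"
  shows "(\<Sum>y\<in>S. mpow S K m x y) = 1"
proof (induction m)
  case 0
  then show ?case using assms by (auto simp: markov_chain_def)
next
  case (Suc m)
  have "(\<Sum>y\<in>S. mpow S K (Suc m) x y) = (\<Sum>z\<in>S. mpow S K m x z * (\<Sum>y\<in>S. K z y))"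
    by (simp add: sum_distrib_left) (rule sum.swap)
  also have "\<dots> = (\<Sum>z\<in>S. mpow S K m x z)"
    using assms by (intro sum.cong) (auto simp: markov_chain_def)
  finally show ?case using Suc by simp
qed

lemma mpow_le_1:
  assumes "markov_chain S K" "x \<in> S" "y \<in> S"
  shows "mpow S K m x y \<le> 1"
  using member_le_sum[of y S "mpow S K m x"] mpow_row_sum[OF assms(1,2), of m] mpow_nonneg[OF assms(1,2)] assms
  by (auto simp: markov_chain_def)

text \<open>Maximum principle: at a maximum point \<open>x0\<close> the nonnegative gaps
  \<open>h x0 - h z\<close> average to 0 under every power of \<open>K\<close>. Irreducibility
  provides a power giving positive weight to any prescribed state, so its gap vanishes.\<close>

lemma irreducible_harmonic_const:
  assumes mc: "markov_chain S K" and irr: "irreducible_chain S K"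
    and harm: "\<And>y. y \<in> S \<Longrightarrow> (\<Sum>z\<in>S. K y z * h z) = h y"
  obtains c :: real where "\<And>y. y \<in> S \<Longrightarrow> h y = c"
proof -
  have fin: "finite S" "S \<noteq> {}" using mc by (auto simp: markov_chain_def)
  have pw: "(\<Sum>z\<in>S. mpow S K m x z * h z) = h x" if "x \<in> S" for m x
  proof (induction m)
    case 0
    have "(\<Sum>z\<in>S. (if x = z then 1 else 0) * h z) = (\<Sum>z\<in>S. if x = z then h z else 0)"
      by (intro sum.cong) auto
    then show ?case using fin that by simp
  next
    case (Suc m)
    have "(\<Sum>z\<in>S. mpow S K (Suc m) x z * h z) = (\<Sum>u\<in>S. mpow S K m x u * (\<Sum>z\<in>S. K u z * h z))"
      by (simp add: sum_distrib_left sum_distrib_right mult.assoc) (rule sum.swap)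
    also have "\<dots> = (\<Sum>u\<in>S. mpow S K m x u * h u)" using harm by (intro sum.cong) auto
    finally show ?case using Suc by simp
  qed
  have "Max (h ` S) \<in> h ` S" using fin by (intro Max_in) auto
  then obtain x0 where x0: "x0 \<in> S" "Max (h ` S) = h x0" by auto
  have mx: "h y \<le> h x0" if "y \<in> S" for y using that fin x0(2)[symmetric] by simp
  have "h y = h x0" if y: "y \<in> S" for y
  proof -
    obtain m where m: "mpow S K m x0 y > 0" using irr x0 y by (auto simp: irreducible_chain_def)
    have "(\<Sum>z\<in>S. mpow S K m x0 z * (h x0 - h z)) = h x0 * (\<Sum>z\<in>S. mpow S K m x0 z) - (\<Sum>z\<in>S. mpow S K m x0 z * h z)"
      by (simp add: algebra_simps sum_subtractf sum_distrib_left)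
    also have "\<dots> = 0" using pw[OF x0(1), of m] mpow_row_sum[OF mc x0(1), of m] by simp
    finally have "mpow S K m x0 y * (h x0 - h y) = 0"
      using sum_nonneg_eq_0_iff[of S "\<lambda>z. mpow S K m x0 z * (h x0 - h z)"] fin mx mpow_nonneg[OF mc x0(1)] y
      by (simp add: mult_nonneg_nonneg)
    then show ?thesis using m by simp
  qed
  then show ?thesis by (rule that)
qed

text \<open>Centred by 1 so that its norm in L^2(\<pi>) is the distance to stationarity.\<close>

definition rel_density :: "'a set \<Rightarrow> ('a \<Rightarrow> 'a \<Rightarrow> real) \<Rightarrow> ('a \<Rightarrow> real) \<Rightarrow> ('a \<Rightarrow> real) \<Rightarrow> nat \<Rightarrow> 'a \<Rightarrow> real" where
  "rel_density S K \<pi> \<mu> k y = (\<Sum>x\<in>S. \<mu> x * mpow S K k x y) / \<pi> y - 1"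

text \<open>Reversibility turns the action of \<open>K\<close> on measures from the right into its
  action on densities from the left, and the unit row sums carry the constant 1 along. The
  hypotheses are listed singly so that they can be checked for \<open>lazy_kernel\<close> at every
  real \<theta>.\<close>

lemma rel_density_Suc:
  assumes rev: "\<And>x y. x \<in> S \<Longrightarrow> y \<in> S \<Longrightarrow> \<pi> x * K x y = \<pi> y * K y x"
    and row: "\<And>x. x \<in> S \<Longrightarrow> (\<Sum>y\<in>S. K x y) = 1"
    and pos: "\<And>x. x \<in> S \<Longrightarrow> \<pi> x > 0" and y: "y \<in> S"
  shows "rel_density S K \<pi> \<mu> (Suc k) y = (\<Sum>z\<in>S. K y z * rel_density S K \<pi> \<mu> k z)"
proof -
  have K: "K z y = \<pi> y * K y z / \<pi> z" if "z \<in> S" for z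
    using rev[OF that y] pos[OF that] by (simp add: field_simps)
  have "(\<Sum>x\<in>S. \<mu> x * mpow S K (Suc k) x y) = (\<Sum>z\<in>S. (\<Sum>x\<in>S. \<mu> x * mpow S K k x z) * K z y)"
    by (simp add: sum_distrib_left sum_distrib_right mult.assoc) (rule sum.swap)
  also have "\<dots> = \<pi> y * (\<Sum>z\<in>S. K y z * ((\<Sum>x\<in>S. \<mu> x * mpow S K k x z) / \<pi> z))"
    unfolding sum_distrib_left[of "\<pi> y"] by (intro sum.cong refl) (simp add: K)
  finally have "(\<Sum>x\<in>S. \<mu> x * mpow S K (Suc k) x y) / \<pi> y = (\<Sum>z\<in>S. K y z * ((\<Sum>x\<in>S. \<mu> x * mpow S K k x z) / \<pi> z))"
    using pos[OF y] by simp
  then show ?thesis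
    unfolding rel_density_def using row[OF y] by (simp only: right_diff_distrib sum_subtractf mult_1_right)
qed

lemma l2dist_eq: "l2dist S \<pi> \<nu> = sqrt (\<Sum>y\<in>S. \<pi> y * ((\<nu> y / \<pi> y - 1) * (\<nu> y / \<pi> y - 1)))"
  by (simp add: l2dist_def power2_eq_square)

text \<open>A linear relation in a finite-dimensional space, obtained by adding one point of
  \<open>S\<close> at a time: two polynomials that annihilate on the old points are combined so that
  their values at the new point cancel.\<close>

lemma exists_annihilating_poly:
  fixes v :: "nat \<Rightarrow> 'a \<Rightarrow> real"
  assumes "finite S"
  obtains p :: "real poly" where "p \<noteq> 0" "\<And>x. x \<in> S \<Longrightarrow> (\<Sum>i\<le>degree p. coeff p i * v i x) = 0"
proof -
  define ev where "ev = (\<lambda>(v :: nat \<Rightarrow> 'a \<Rightarrow> real) p x. \<Sum>i\<le>degree p. coeff p i * v i x)"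
  have ev: "ev v p x = (\<Sum>i\<le>n. coeff p i * v i x)" if "degree p \<le> n" for v p x n
    unfolding ev_def using that by (intro sum.mono_neutral_left) (auto simp: coeff_eq_0 not_le)
  have ev_monom: "ev v (monom 1 d * p) x = ev (\<lambda>i. v (d + i)) p x" for v p x d
  proof -
    have le: "degree (monom 1 d * p) \<le> d + degree p"
      by (metis degree_monom_eq degree_mult_le one_neq_zero)
    have "ev v (monom 1 d * p) x = (\<Sum>i\<in>{d..d + degree p}. coeff (monom 1 d * p) i * v i x)"
      unfolding ev[OF le] by (rule sum.mono_neutral_right) (auto simp: coeff_monom_mult)
    also have "\<dots> = (\<Sum>i\<le>degree p. coeff p i * v (d + i) x)"
      by (rule sum.reindex_bij_witness[of _ "\<lambda>i. d + i" "\<lambda>i. i - d"]) (auto simp: coeff_monom_mult)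
    finally show ?thesis by (simp add: ev_def)
  qed
  have "\<exists>p. p \<noteq> 0 \<and> (\<forall>x\<in>S. ev v p x = 0)" using assms
  proof (induction S arbitrary: v)
    case empty
    then show ?case by (auto intro: exI[of _ 1])
  next
    case (insert x S)
    obtain p where p: "p \<noteq> 0" "\<forall>x\<in>S. ev v p x = 0" using insert.IH by blast
    \<comment> \<open>The induction hypothesis for the sequence shifted by \<open>d\<close> yields a
      second annihilator \<open>q\<close> of degree greater than that of \<open>p\<close>. Hence the
      leading coefficient of \<open>q\<close> survives in the combination \<open>r\<close>, which is
      therefore nonzero.\<close>
    define d where "d = Suc (degree p)"
    obtain p' where p': "p' \<noteq> 0" "\<forall>x\<in>S. ev (\<lambda>i. v (d + i)) p' x = 0" using insert.IH by blast
    define q where "q = monom 1 d * p'"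
    have q: "q \<noteq> 0" "\<forall>x\<in>S. ev v q x = 0" using p' by (auto simp: q_def ev_monom)
    have dq: "degree q > degree p"
      using p' by (simp add: q_def degree_mult_eq degree_monom_eq d_def)
    define r where "r = smult (ev v p x) q - smult (ev v q x) p"
    have dr: "degree r \<le> degree q" unfolding r_def using dq
      by (intro degree_diff_le) (auto intro: order.trans[OF degree_smult_le])
    have rr: "ev v r y = ev v p x * ev v q y - ev v q x * ev v p y" for y
    proof -
      have "ev v r y = (\<Sum>i\<le>degree q. coeff r i * v i y)" by (rule ev[OF dr])
      also have "\<dots> = ev v p x * (\<Sum>i\<le>degree q. coeff q i * v i y) - ev v q x * (\<Sum>i\<le>degree q. coeff p i * v i y)"
        by (simp add: r_def sum_subtractf sum_distrib_left left_diff_distrib mult.assoc)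
      finally show ?thesis unfolding ev[OF less_imp_le[OF dq], symmetric] ev[OF order.refl, symmetric] .
    qed
    show ?case
    proof (cases "ev v p x = 0")
      case True
      then show ?thesis using p by auto
    next
      case False
      have "coeff r (degree q) = ev v p x * lead_coeff q" using dq by (simp add: r_def coeff_eq_0)
      then have "r \<noteq> 0" using False q by auto
      moreover have "ev v r y = 0" if "y \<in> insert x S" for y
        using that p q by (auto simp: rr)
      ultimately show ?thesis by blast
    qed
  qed
  then show ?thesis using that unfolding ev_def by blast
qed

text \<open>
  With \<open>v k = \<mu> K^k / \<pi> - 1 = K^k (v 0)\<close> and \<open>H p = p(K) (v 0)\<close>, self-adjointness of \<open>K\<close> gives
  \<open>\<langle>H p, H q\<rangle> = L (p * q)\<close> for \<open>L p = \<langle>v 0, H p\<rangle>\<close>; the measure representing \<open>L\<close> is the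
  spectral measure of \<open>v 0\<close>. It does not charge the eigenvalue 1, because \<open>v 0\<close> is orthogonal to
  the constants, which by irreducibility are the only harmonic functions.
\<close>

lemma spectral_measure:
  assumes mc: "markov_chain S K" and irr: "irreducible_chain S K"
    and revc: "reversible_chain S K \<pi>" and init: "prob_dist S \<mu>"
  obtains B w where "finite B" "\<And>l. l \<in> B \<Longrightarrow> 0 < l \<and> l \<le> 2 \<and> 0 \<le> w l"
    "\<And>\<theta> m. d2_disc S (lazy_kernel \<theta> K) \<pi> \<mu> m = sqrt (\<Sum>l\<in>B. w l * (1 - (1 - \<theta>) * l) ^ (2 * m))"
    "\<And>t. d2_cont S K \<pi> \<mu> t = sqrt (\<Sum>l\<in>B. w l * exp (- (2 * t * l)))"
    "(\<Sum>l\<in>B. w l) = (\<Sum>y\<in>S. (\<mu> y)\<^sup>2 / \<pi> y) - 1"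
proof -
  have fin: "finite S" using mc by (simp add: markov_chain_def)
  have row: "\<And>x. x \<in> S \<Longrightarrow> (\<Sum>y\<in>S. K x y) = 1" using mc by (simp add: markov_chain_def)
  have pos: "\<And>x. x \<in> S \<Longrightarrow> \<pi> x > 0" and rev: "\<And>x y. x \<in> S \<Longrightarrow> y \<in> S \<Longrightarrow> \<pi> x * K x y = \<pi> y * K y x"
    and pisum: "(\<Sum>x\<in>S. \<pi> x) = 1"
    using revc by (auto simp: reversible_chain_def prob_dist_def)
  have nz: "\<pi> x \<noteq> 0" if "x \<in> S" for x using pos[OF that] by simp
  have mu: "\<And>x. x \<in> S \<Longrightarrow> \<mu> x \<ge> 0" "(\<Sum>x\<in>S. \<mu> x) = 1" using init by (auto simp: prob_dist_def)
  let ?v = "rel_density S K \<pi> \<mu>"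
  define ip where "ip = (\<lambda>f g. \<Sum>y\<in>S. \<pi> y * (f y * g y))"
  define A where "A = (\<lambda>f x. \<Sum>y\<in>S. K x y * f y)"
  define H where "H = (\<lambda>p y. \<Sum>i\<le>degree p. coeff p i * ?v i y)"
  define L where "L = (\<lambda>p. ip (?v 0) (H p))"
  have ip_cong: "ip f g = ip f' g'" if "\<And>y. y \<in> S \<Longrightarrow> f y = f' y" "\<And>y. y \<in> S \<Longrightarrow> g y = g' y" for f g f' g'
    unfolding ip_def using that by (intro sum.cong) auto
  have ip_add: "ip (\<lambda>y. f y + g y) h = ip f h + ip g h" "ip h (\<lambda>y. f y + g y) = ip h f + ip h g"
    and ip_mult: "ip (\<lambda>y. c * f y) h = c * ip f h" "ip h (\<lambda>y. c * f y) = c * ip h f" for f g h c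
    by (simp_all add: ip_def algebra_simps sum.distrib sum_distrib_left)
  have ip_pos: "ip f f \<ge> 0" for f
    unfolding ip_def using pos by (intro sum_nonneg mult_nonneg_nonneg[OF less_imp_le zero_le_square]) auto
  have ip_zero: "f y = 0" if "ip f f = 0" "y \<in> S" for f y
  proof -
    have "\<pi> y * (f y * f y) = 0"
      using that sum_nonneg_eq_0_iff[of S "\<lambda>y. \<pi> y * (f y * f y)"] fin pos
      by (simp add: ip_def less_imp_le)
    then show ?thesis using pos[OF that(2)] by simp
  qed
  have ip_A: "ip (A f) g = ip f (A g)" for f g
  proof -
    have "ip (A f) g = (\<Sum>x\<in>S. \<Sum>y\<in>S. \<pi> x * K x y * (f y * g x))"
      by (simp add: ip_def A_def sum_distrib_left sum_distrib_right algebra_simps)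
    also have "\<dots> = (\<Sum>x\<in>S. \<Sum>y\<in>S. \<pi> y * K y x * (f y * g x))"
      using rev by (intro sum.cong) auto
    also have "\<dots> = (\<Sum>y\<in>S. \<Sum>x\<in>S. \<pi> y * K y x * (f y * g x))" by (rule sum.swap)
    also have "\<dots> = ip f (A g)" by (simp add: ip_def A_def sum_distrib_left sum_distrib_right algebra_simps)
    finally show ?thesis .
  qed
  have A_cong: "A f = A g" if "\<And>y. y \<in> S \<Longrightarrow> f y = g y" for f g
    unfolding A_def using that by (intro ext sum.cong) auto
  have v_Suc: "?v (Suc k) y = A (?v k) y" if "y \<in> S" for k y
    unfolding A_def using rev row pos that by (rule rel_density_Suc)
  have H: "H p y = (\<Sum>i\<le>n. coeff p i * ?v i y)" if "degree p \<le> n" for p n y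
    unfolding H_def using that by (intro sum.mono_neutral_left) (auto simp: coeff_eq_0 not_le)
  have H_add: "H (p + q) y = H p y + H q y" for p q y
  proof -
    define n where "n = max (degree p) (degree q)"
    have "degree (p + q) \<le> n" "degree p \<le> n" "degree q \<le> n"
      unfolding n_def by (auto intro: degree_add_le_max)
    then show ?thesis by (simp add: H[of _ n] sum.distrib algebra_simps)
  qed
  have H_smult: "H (smult c p) y = c * H p y" for c p y
    by (simp add: H[OF degree_smult_le] H_def sum_distrib_left mult.assoc)
  have H_shift: "H (pCons 0 p) y = A (H p) y" if "y \<in> S" for p y
  proof -
    have "H (pCons 0 p) y = (\<Sum>i\<le>Suc (degree p). coeff (pCons 0 p) i * ?v i y)"
      by (rule H) (simp add: degree_pCons_le)
    also have "\<dots> = (\<Sum>i\<le>degree p. coeff p i * A (?v i) y)"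
      using v_Suc[OF that] by (simp add: sum.atMost_Suc_shift del: sum.atMost_Suc)
    also have "\<dots> = A (H p) y"
      unfolding A_def H_def sum_distrib_left by (subst sum.swap) (simp add: mult_ac)
    finally show ?thesis .
  qed
  have H_const: "H [:a:] y = a * ?v 0 y" for a y by (simp add: H_def)
  have H_pCons: "H (pCons a p) y = a * ?v 0 y + A (H p) y" if "y \<in> S" for a p y
  proof -
    have "pCons a p = [:a:] + pCons 0 p" by simp
    then show ?thesis using H_add[of "[:a:]" "pCons 0 p" y] H_const H_shift[OF that] by simp
  qed
  \<comment> \<open>Self-adjointness moves the factors \<open>K\<close> of \<open>p\<close> one at a
    time to the right, which is induction on \<open>p\<close> with \<open>q\<close>
    arbitrary.\<close>
  have LH: "ip (H p) (H q) = L (p * q)" for p q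
  proof (induction p arbitrary: q)
    case 0
    then show ?case by (simp add: L_def H_def ip_def)
  next
    case (pCons a p)
    have "ip (H (pCons a p)) (H q) = a * ip (?v 0) (H q) + ip (A (H p)) (H q)"
      unfolding ip_add[symmetric] ip_mult[symmetric] by (rule ip_cong) (auto simp: H_pCons)
    also have "ip (A (H p)) (H q) = ip (H p) (H (pCons 0 q))"
      unfolding ip_A by (rule ip_cong) (auto simp: H_shift)
    also have "\<dots> = L (p * pCons 0 q)" by (rule pCons.IH)
    also have "a * ip (?v 0) (H q) + L (p * pCons 0 q) = L (smult a q + p * pCons 0 q)"
      by (simp add: L_def H_add[abs_def] H_smult[abs_def] ip_add ip_mult)
    also have "smult a q + p * pCons 0 q = pCons a p * q" by simp
    finally show ?case .
  qed
  have L_add: "L (p + q) = L p + L q" and L_smult: "L (smult c p) = c * L p" for p q c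
    by (simp_all add: L_def H_add[abs_def] H_smult[abs_def] ip_add ip_mult)
  have L_pos: "L (p * p) \<ge> 0" for p using ip_pos[of "H p"] by (simp add: LH)
  obtain p0 :: "real poly" where p0: "p0 \<noteq> 0" "\<And>x. x \<in> S \<Longrightarrow> H p0 x = 0"
    unfolding H_def using exists_annihilating_poly[OF fin, of ?v] by blast
  have L_ann: "L (p0 * q) = 0" for q
  proof -
    have "L (p0 * q) = ip (\<lambda>_. 0) (H q)" unfolding LH[symmetric] by (rule ip_cong) (auto simp: p0)
    then show ?thesis by (simp add: ip_def)
  qed
  obtain B0 w where B0: "finite B0" "\<forall>\<beta>\<in>B0. 0 \<le> w \<beta>" and L0: "\<And>q. L q = (\<Sum>\<beta>\<in>B0. w \<beta> * poly q \<beta>)"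
    using positive_functional_representation[OF L_add L_smult L_pos p0(1) L_ann] by blast
  \<comment> \<open>Null atoms are discarded: only atoms of positive mass can be located by bounds
    on \<open>L\<close>.\<close>
  define B where "B = {\<beta>\<in>B0. w \<beta> > 0}"
  have B: "finite B" "\<And>\<beta>. \<beta> \<in> B \<Longrightarrow> w \<beta> > 0" using B0 by (auto simp: B_def)
  have LB: "L q = (\<Sum>\<beta>\<in>B. w \<beta> * poly q \<beta>)" for q
    unfolding L0 B_def using B0 by (intro sum.mono_neutral_right) force+
  have H_monom: "H (monom c k) y = c * ?v k y" for c k y
  proof -
    have "H (monom c k) y = (\<Sum>i\<le>k. if k = i then c * ?v i y else 0)"
      unfolding H[OF degree_monom_le] by (intro sum.cong) auto
    then show ?thesis by simp
  qed
  have mpow01: "0 \<le> mpow S K k x y" "mpow S K k x y \<le> 1" if "x \<in> S" "y \<in> S" for k x y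
    using mpow_nonneg[OF mc that] mpow_le_1[OF mc that] by auto
  have v_bound: "\<bar>?v k y\<bar> \<le> 1 / \<pi> y + 1" if "y \<in> S" for k y
  proof -
    have "(\<Sum>x\<in>S. \<mu> x * mpow S K k x y) \<le> (\<Sum>x\<in>S. \<mu> x * 1)"
      using mpow01 mu that by (intro sum_mono mult_left_mono) auto
    moreover have "(\<Sum>x\<in>S. \<mu> x * mpow S K k x y) \<ge> 0"
      using mpow01 mu that by (intro sum_nonneg mult_nonneg_nonneg) auto
    ultimately have "0 \<le> (\<Sum>x\<in>S. \<mu> x * mpow S K k x y) / \<pi> y" "(\<Sum>x\<in>S. \<mu> x * mpow S K k x y) / \<pi> y \<le> 1 / \<pi> y"
      using pos[OF that] mu(2) by (auto simp: field_simps)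
    then show ?thesis unfolding rel_density_def by linarith
  qed
  \<comment> \<open>An atom outside [-1, 1] would make the squared norm of \<open>?v m\<close> grow
    geometrically in \<open>m\<close>, while \<open>v_bound\<close> bounds that norm
    uniformly.\<close>
  have abs1: "\<bar>\<beta>\<bar> \<le> 1" if \<beta>: "\<beta> \<in> B" for \<beta>
  proof (rule ccontr)
    assume "\<not> \<bar>\<beta>\<bar> \<le> 1"
    then have big: "1 < \<beta>\<^sup>2" by (simp add: abs_square_le_1 not_le[symmetric])
    define C where "C = (\<Sum>y\<in>S. \<pi> y * (1 / \<pi> y + 1)\<^sup>2)"
    have "w \<beta> * (\<beta>\<^sup>2) ^ m \<le> C" for m
    proof -
      have "w \<beta> * (\<beta>\<^sup>2) ^ m \<le> (\<Sum>\<beta>\<in>B. w \<beta> * (\<beta>\<^sup>2) ^ m)"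
        using B \<beta> by (intro member_le_sum) (auto intro!: mult_nonneg_nonneg less_imp_le[OF B(2)])
      also have "\<dots> = L (monom 1 m * monom 1 m)"
        unfolding LB by (simp add: poly_monom power_mult[symmetric] power_add[symmetric] mult_2)
      also have "\<dots> = ip (?v m) (?v m)" unfolding LH[symmetric] by (rule ip_cong) (auto simp: H_monom)
      also have "\<dots> \<le> C"
        unfolding ip_def C_def
      proof (intro sum_mono mult_left_mono)
        fix y assume "y \<in> S"
        then show "?v m y * ?v m y \<le> (1 / \<pi> y + 1)\<^sup>2" "0 \<le> \<pi> y"
          using v_bound[of y m] pos[of y] power_mono[of "\<bar>?v m y\<bar>" "1 / \<pi> y + 1" 2]
          by (auto simp: power2_eq_square)
      qed
      finally show ?thesis .
    qed
    moreover obtain m where "C / w \<beta> < (\<beta>\<^sup>2) ^ m" using real_arch_pow[OF big] by blast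
    then have "C < w \<beta> * (\<beta>\<^sup>2) ^ m" using B(2)[OF \<beta>] by (simp add: field_simps)
    ultimately show False by (meson not_le)
  qed
  have v_mean: "(\<Sum>y\<in>S. \<pi> y * ?v k y) = 0" for k
  proof -
    have "(\<Sum>y\<in>S. \<pi> y * ?v k y) = (\<Sum>y\<in>S. (\<Sum>x\<in>S. \<mu> x * mpow S K k x y) - \<pi> y)"
      by (intro sum.cong) (auto simp: rel_density_def nz right_diff_distrib)
    also have "\<dots> = (\<Sum>x\<in>S. \<mu> x * (\<Sum>y\<in>S. mpow S K k x y)) - 1"
      unfolding sum_subtractf pisum sum_distrib_left by (subst sum.swap) simp
    also have "(\<Sum>x\<in>S. \<mu> x * (\<Sum>y\<in>S. mpow S K k x y)) = (\<Sum>x\<in>S. \<mu> x)"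
      using mpow_row_sum[OF mc] by (intro sum.cong) auto
    finally show ?thesis using mu by simp
  qed
  have ne1: "1 \<notin> B"
  proof
    assume 1: "1 \<in> B"
    \<comment> \<open>\<open>q\<close> vanishes at every other atom, so \<open>(X - 1) q\<close>
      vanishes on all of \<open>B\<close> and \<open>H q\<close> is harmonic, hence constant. Its
      mean under \<pi> is 0, so it vanishes, which contradicts the mass at 1.\<close>
    define q :: "real poly" where "q = (\<Prod>\<beta>\<in>B - {1}. [:-\<beta>, 1:])"
    have q1: "poly q 1 \<noteq> 0" using B by (auto simp: q_def poly_prod)
    have qB: "poly q \<beta> = 0" if "\<beta> \<in> B" "\<beta> \<noteq> 1" for \<beta>
      using B that by (auto simp: q_def poly_prod)
    have "ip (H ([:-1, 1:] * q)) (H ([:-1, 1:] * q)) = 0"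
      unfolding LH LB by (intro sum.neutral) (use qB in auto)
    then have z: "H ([:-1, 1:] * q) y = 0" if "y \<in> S" for y using ip_zero that by blast
    have harm: "(\<Sum>z\<in>S. K y z * H q z) = H q y" if "y \<in> S" for y
    proof -
      have "[:-1, 1:] * q = smult (-1) q + pCons 0 q" by simp
      then have "H ([:-1, 1:] * q) y = - H q y + A (H q) y"
        using that by (simp only: H_add H_smult H_shift)
      then show ?thesis using z[OF that] by (simp add: A_def)
    qed
    obtain c where c: "\<And>y. y \<in> S \<Longrightarrow> H q y = c"
      using irreducible_harmonic_const[OF mc irr harm] by blast
    have "c = (\<Sum>y\<in>S. \<pi> y * H q y)" using pisum c by (simp add: sum_distrib_right[symmetric])
    also have "\<dots> = (\<Sum>i\<le>degree q. coeff q i * (\<Sum>y\<in>S. \<pi> y * ?v i y))"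
      unfolding H_def sum_distrib_left by (subst sum.swap) (simp add: mult_ac)
    finally have "c = 0" by (simp add: v_mean)
    then have "ip (H q) (H q) = 0" using c by (simp add: ip_def)
    moreover have "w 1 * poly (q * q) 1 \<le> L (q * q)"
      unfolding LB using 1 B by (intro member_le_sum[where f = "\<lambda>\<beta>. w \<beta> * poly (q * q) \<beta>"]) (auto simp: less_imp_le)
    moreover have "w 1 * poly (q * q) 1 > 0" using B(2)[OF 1] q1 by (auto simp: zero_less_mult_iff neq_iff)
    ultimately show False by (simp add: LH)
  qed
  \<comment> \<open>The lazy kernel is the polynomial \<open>\<theta> + (1 - \<theta>) X\<close>
    evaluated at \<open>K\<close>, so the same measure serves the lazy chain.\<close>
  have lazy: "rel_density S (lazy_kernel \<theta> K) \<pi> \<mu> m y = H ([:\<theta>, 1 - \<theta>:] ^ m) y" if "y \<in> S" for \<theta> m y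
    using that
  proof (induction m arbitrary: y)
    case 0
    then show ?case by (simp add: H_def rel_density_def)
  next
    case (Suc m)
    let ?q = "[:\<theta>, 1 - \<theta>:] ^ m"
    have delta: "(\<Sum>z\<in>S. (if y = z then 1 else 0) * f z) = f y" if "y \<in> S" for f :: "'a \<Rightarrow> real" and y
    proof -
      have "(\<Sum>z\<in>S. (if y = z then 1 else 0) * f z) = (\<Sum>z\<in>S. if y = z then f z else 0)"
        by (intro sum.cong) auto
      then show ?thesis using fin that by simp
    qed
    have lz: "(\<Sum>z\<in>S. lazy_kernel \<theta> K y z * f z) = \<theta> * f y + (1 - \<theta>) * A f y" if "y \<in> S" for f y
    proof -
      have "(\<Sum>z\<in>S. lazy_kernel \<theta> K y z * f z) = \<theta> * (\<Sum>z\<in>S. (if y = z then 1 else 0) * f z) + (1 - \<theta>) * A f y"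
        unfolding lazy_kernel_def A_def sum_distrib_left sum.distrib[symmetric] by (intro sum.cong refl) (simp add: algebra_simps)
      then show ?thesis using delta[OF that] by simp
    qed
    have "rel_density S (lazy_kernel \<theta> K) \<pi> \<mu> (Suc m) y = (\<Sum>z\<in>S. lazy_kernel \<theta> K y z * rel_density S (lazy_kernel \<theta> K) \<pi> \<mu> m z)"
    proof (rule rel_density_Suc)
      show "\<pi> x * lazy_kernel \<theta> K x y = \<pi> y * lazy_kernel \<theta> K y x" if "x \<in> S" "y \<in> S" for x y
        using rev[OF that] by (simp add: lazy_kernel_def algebra_simps)
      show "(\<Sum>y\<in>S. lazy_kernel \<theta> K x y) = 1" if "x \<in> S" for x
        using lz[OF that, of "\<lambda>_. 1"] row[OF that] by (simp add: A_def)
    qed (use pos Suc.prems in auto)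
    also have "\<dots> = (\<Sum>z\<in>S. lazy_kernel \<theta> K y z * H ?q z)" using Suc.IH by (intro sum.cong) auto
    also have "\<dots> = \<theta> * H ?q y + (1 - \<theta>) * A (H ?q) y" by (rule lz[OF Suc.prems])
    also have "\<dots> = H (smult \<theta> ?q + smult (1 - \<theta>) (pCons 0 ?q)) y"
      by (simp only: H_add H_smult H_shift[OF Suc.prems])
    also have "smult \<theta> ?q + smult (1 - \<theta>) (pCons 0 ?q) = [:\<theta>, 1 - \<theta>:] ^ Suc m" by simp
    finally show ?case .
  qed
  have disc: "d2_disc S (lazy_kernel \<theta> K) \<pi> \<mu> m = sqrt (\<Sum>\<beta>\<in>B. w \<beta> * (\<theta> + (1 - \<theta>) * \<beta>) ^ (2 * m))" for \<theta> m
  proof -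
    let ?q = "[:\<theta>, 1 - \<theta>:] ^ m"
    have "d2_disc S (lazy_kernel \<theta> K) \<pi> \<mu> m = sqrt (ip (rel_density S (lazy_kernel \<theta> K) \<pi> \<mu> m) (rel_density S (lazy_kernel \<theta> K) \<pi> \<mu> m))"
      by (simp add: d2_disc_def l2dist_eq ip_def rel_density_def)
    also have "ip (rel_density S (lazy_kernel \<theta> K) \<pi> \<mu> m) (rel_density S (lazy_kernel \<theta> K) \<pi> \<mu> m) = ip (H ?q) (H ?q)"
      by (rule ip_cong) (auto simp: lazy)
    also have "\<dots> = (\<Sum>\<beta>\<in>B. w \<beta> * (\<theta> + (1 - \<theta>) * \<beta>) ^ (2 * m))"
      unfolding LH LB by (simp add: mult_2 power_add) (simp add: mult.commute)
    finally show ?thesis .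
  qed
  have cont: "d2_cont S K \<pi> \<mu> t = sqrt (\<Sum>\<beta>\<in>B. w \<beta> * exp (- (2 * t * (1 - \<beta>))))" for t
  proof -
    define p where "p = (\<lambda>k. exp (- t) * t ^ k / fact k)"
    define h where "h = (\<lambda>y. (\<Sum>x\<in>S. \<mu> x * heat S K t x y) / \<pi> y - 1)"
    \<comment> \<open>Truncations of the heat series are polynomials in \<open>K\<close>, to which
      \<open>LH\<close> applies. Letting \<open>N\<close> grow identifies the squared norm of
      \<open>h\<close> with an integral of exponentials.\<close>
    define Q where "Q = (\<lambda>N. \<Sum>k<N. monom (p k) k)"
    have psum: "(\<lambda>k. p k * \<beta> ^ k) sums (exp (- t) * exp (t * \<beta>))" for \<beta>
    proof -
      have "(\<lambda>k. exp (- t) * ((t * \<beta>) ^ k /\<^sub>R fact k)) sums (exp (- t) * exp (t * \<beta>))"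
        by (intro sums_mult exp_converges)
      then show ?thesis by (simp add: p_def power_mult_distrib field_simps)
    qed
    have pabs: "summable (\<lambda>k. \<bar>p k\<bar>)"
    proof -
      have "summable (\<lambda>k. exp (- t) * (\<bar>t\<bar> ^ k /\<^sub>R fact k))"
        by (intro summable_mult sums_summable[OF exp_converges])
      then show ?thesis by (simp add: p_def abs_mult power_abs field_simps)
    qed
    have heat: "(\<lambda>k. p k * mpow S K k x y) sums heat S K t x y" if "x \<in> S" "y \<in> S" for x y
    proof -
      have "summable (\<lambda>k. p k * mpow S K k x y)"
      proof (rule summable_comparison_test[OF _ pabs])
        show "\<exists>N. \<forall>n\<ge>N. norm (p n * mpow S K n x y) \<le> \<bar>p n\<bar>"
          using mpow01[OF that] by (auto simp: abs_mult intro!: mult_left_le)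
      qed
      then show ?thesis unfolding heat_def p_def by (rule summable_sums)
    qed
    have hsum: "(\<lambda>k. p k * ?v k y) sums h y" if "y \<in> S" for y
    proof -
      \<comment> \<open>The weights \<open>p k\<close> sum to 1, so the centring constant 1 is
        spread over the series by \<open>psum\<close> at 1.\<close>
      have "(\<lambda>k. (\<Sum>x\<in>S. \<mu> x * (p k * mpow S K k x y)) / \<pi> y - p k * 1 ^ k) sums
        ((\<Sum>x\<in>S. \<mu> x * heat S K t x y) / \<pi> y - exp (- t) * exp (t * 1))"
        by (intro sums_diff sums_divide sums_sum sums_mult heat psum that)
      moreover have "(\<Sum>x\<in>S. \<mu> x * (p k * mpow S K k x y)) / \<pi> y - p k * 1 ^ k = p k * ?v k y" for k
        by (simp add: rel_density_def right_diff_distrib sum_distrib_left mult_ac)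
      ultimately show ?thesis by (simp add: h_def exp_add[symmetric])
    qed
    have HQ: "H (Q N) y = (\<Sum>k<N. p k * ?v k y)" for N y
      by (induction N) (simp_all add: Q_def H_add H_monom, simp add: H_def)
    have "(\<lambda>N. ip (H (Q N)) (H (Q N))) \<longlonglongrightarrow> ip h h"
      unfolding ip_def HQ by (intro tendsto_intros) (use hsum in \<open>auto simp: sums_def\<close>)
    moreover have "(\<lambda>N. ip (H (Q N)) (H (Q N))) \<longlonglongrightarrow> (\<Sum>\<beta>\<in>B. w \<beta> * ((exp (- t) * exp (t * \<beta>)) * (exp (- t) * exp (t * \<beta>))))"
      unfolding LH LB poly_mult Q_def poly_sum poly_monom
      by (intro tendsto_intros) (use psum in \<open>auto simp: sums_def\<close>)
    ultimately have "ip h h = (\<Sum>\<beta>\<in>B. w \<beta> * ((exp (- t) * exp (t * \<beta>)) * (exp (- t) * exp (t * \<beta>))))"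
      by (rule LIMSEQ_unique)
    also have "\<dots> = (\<Sum>\<beta>\<in>B. w \<beta> * exp (- (2 * t * (1 - \<beta>))))"
      by (simp add: exp_add[symmetric] algebra_simps)
    finally show ?thesis by (simp add: d2_cont_def l2dist_eq h_def ip_def)
  qed
  have mass: "(\<Sum>\<beta>\<in>B. w \<beta>) = (\<Sum>y\<in>S. (\<mu> y)\<^sup>2 / \<pi> y) - 1"
  proof -
    have v0: "?v 0 y = \<mu> y / \<pi> y - 1" if "y \<in> S" for y
    proof -
      have "(\<Sum>x\<in>S. \<mu> x * (if x = y then 1 else 0)) = (\<Sum>x\<in>S. if x = y then \<mu> x else 0)" by (intro sum.cong) auto
      then show ?thesis using fin that by (simp add: rel_density_def)
    qed
    have "(\<Sum>\<beta>\<in>B. w \<beta>) = L (1 * 1)" unfolding LB by simp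
    also have "\<dots> = ip (?v 0) (?v 0)" unfolding LH[symmetric] by (rule ip_cong) (auto simp: H_def)
    also have "\<dots> = (\<Sum>y\<in>S. (\<mu> y)\<^sup>2 / \<pi> y - 2 * \<mu> y + \<pi> y)"
      unfolding ip_def by (intro sum.cong) (auto simp: v0 nz field_simps power2_eq_square)
    also have "\<dots> = (\<Sum>y\<in>S. (\<mu> y)\<^sup>2 / \<pi> y) - 1"
      by (simp add: sum.distrib sum_subtractf sum_distrib_left[symmetric] mu pisum)
    finally show ?thesis .
  qed
  have inj: "inj_on (\<lambda>\<beta>. 1 - \<beta>) B" for B :: "real set" by (auto simp: inj_on_def)
  show ?thesis
  \<comment> \<open>Passage from eigenvalues \<beta> of \<open>K\<close> to eigenvalues
    \<open>1 - \<beta>\<close> of \<open>I - K\<close>.\<close>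
  proof (rule that[of "(\<lambda>\<beta>. 1 - \<beta>) ` B" "\<lambda>l. w (1 - l)"])
    fix l assume "l \<in> (\<lambda>\<beta>. 1 - \<beta>) ` B"
    then obtain \<beta> where \<beta>: "\<beta> \<in> B" "l = 1 - \<beta>" by auto
    then show "0 < l \<and> l \<le> 2 \<and> 0 \<le> w (1 - l)"
      using abs1[OF \<beta>(1)] ne1 B(2)[OF \<beta>(1)] by (cases "\<beta> = 1") auto
  qed (use B mass in \<open>simp_all add: disc cont sum.reindex[OF inj] algebra_simps\<close>)
qed

subsection \<open>Energies of a spectral measure\<close>

definition cont_energy :: "real set \<Rightarrow> (real \<Rightarrow> real) \<Rightarrow> real \<Rightarrow> real" where
  "cont_energy B w t = (\<Sum>l\<in>B. w l * exp (- (2 * t * l)))"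

definition lazy_energy :: "real set \<Rightarrow> (real \<Rightarrow> real) \<Rightarrow> real \<Rightarrow> nat \<Rightarrow> real" where
  "lazy_energy B w \<theta> m = (\<Sum>l\<in>B. w l * (1 - (1 - \<theta>) * l) ^ (2 * m))"

text \<open>The distribution function of the spectral measure. Summing over all of \<open>B\<close>
  with zero terms allows comparison with the energies term by term.\<close>

definition low_mass :: "real set \<Rightarrow> (real \<Rightarrow> real) \<Rightarrow> real \<Rightarrow> real" where
  "low_mass B w r = (\<Sum>l\<in>B. if l \<le> r then w l else 0)"

definition cont_time :: "real set \<Rightarrow> (real \<Rightarrow> real) \<Rightarrow> real \<Rightarrow> real" where
  "cont_time B w \<epsilon> = Inf {t. t \<ge> 0 \<and> sqrt (cont_energy B w t) \<le> \<epsilon>}"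

definition lazy_time :: "real set \<Rightarrow> (real \<Rightarrow> real) \<Rightarrow> real \<Rightarrow> real \<Rightarrow> nat" where
  "lazy_time B w \<theta> \<epsilon> = (LEAST m. sqrt (lazy_energy B w \<theta> m) \<le> \<epsilon>)"

text \<open>On the segment from 0 to \<open>ln (2 * \<theta> - 1)\<close> the convex function exp
  lies below its chord; at the parameter \<open>l / 2\<close> the chord is exactly the eigenvalue of
  the lazy kernel. This is where the constant of the upper ratio bound comes from.\<close>

lemma exp_chord:
  assumes "1/2 < \<theta>" "\<theta> < 1" "0 \<le> l" "l \<le> (2::real)"
  shows "exp (- (- ln (2 * \<theta> - 1) / 2 * l)) \<le> 1 - (1 - \<theta>) * l"
proof -
  let ?c = "ln (2 * \<theta> - 1)"
  have "exp ((1 - l / 2) * 0 + l / 2 * ?c) \<le> (1 - l / 2) * exp 0 + l / 2 * exp ?c"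
    using convex_onD[OF exp_convex, of "l / 2" 0 ?c] assms by (simp add: algebra_simps)
  also have "\<dots> = 1 - (1 - \<theta>) * l" using assms by (simp add: field_simps)
  finally show ?thesis by (simp add: mult.commute)
qed

text \<open>A lower bound for lazy eigenvalues near 1 that is also available at \<theta> = 1/2,
  where the logarithm in \<open>exp_chord\<close> degenerates.\<close>

lemma exp_minus_double_le:
  assumes "0 \<le> u" "u \<le> (1/2::real)"
  shows "exp (- (2 * u)) \<le> 1 - u"
proof -
  have "1 \<le> (1 + 2 * u) * (1 - u)" using assms mult_right_mono[of u "1/2" u] by (simp add: algebra_simps)
  also have "\<dots> \<le> exp (2 * u) * (1 - u)" using assms by (intro mult_right_mono exp_ge_add_one_self) auto
  finally show ?thesis by (simp add: exp_minus field_simps)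
qed

locale spectral =
  fixes B :: "real set" and w :: "real \<Rightarrow> real"
  assumes fin: "finite B" and range: "l \<in> B \<Longrightarrow> 0 < l \<and> l \<le> 2 \<and> 0 \<le> w l"
begin

abbreviation "ce \<equiv> cont_energy B w"
abbreviation "le \<equiv> lazy_energy B w"
abbreviation "lm \<equiv> low_mass B w"

text \<open>Since \<open>l \<le> 2\<close>, laziness at least 1/2 rules out negative eigenvalues, so
  powers decrease. The last bound limits the loss of energy in one step.\<close>

lemma lazy_base:
  assumes "l \<in> B" "1/2 \<le> \<theta>" "\<theta> < 1"
  shows "0 \<le> 1 - (1 - \<theta>) * l" "1 - (1 - \<theta>) * l < 1" "2 * \<theta> - 1 \<le> 1 - (1 - \<theta>) * l"
proof -
  have "(1 - \<theta>) * l \<le> (1 - \<theta>) * 2" using range[OF assms(1)] assms by (intro mult_left_mono) auto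
  moreover have "0 < (1 - \<theta>) * l" using range[OF assms(1)] assms by simp
  ultimately show "0 \<le> 1 - (1 - \<theta>) * l" "1 - (1 - \<theta>) * l < 1" "2 * \<theta> - 1 \<le> 1 - (1 - \<theta>) * l" using assms by auto
qed

section \<open>Comparison, decay and convexity of the energies\<close>

lemma cont_energy_nonneg: "0 \<le> ce t"
  unfolding cont_energy_def using range by (intro sum_nonneg) auto

lemma lazy_energy_nonneg: "0 \<le> le \<theta> m"
  unfolding lazy_energy_def using range by (intro sum_nonneg) (auto simp: power_mult)

lemma low_mass_nonneg: "0 \<le> lm r"
  unfolding low_mass_def using range by (intro sum_nonneg) auto

lemma low_mass_mono: "r \<le> s \<Longrightarrow> lm r \<le> lm s"
  unfolding low_mass_def using range by (intro sum_mono) auto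

lemma cont_energy_antimono: "s \<le> t \<Longrightarrow> ce t \<le> ce s"
  unfolding cont_energy_def using range by (intro sum_mono mult_left_mono) auto

lemma lazy_energy_antimono:
  "1/2 \<le> \<theta> \<Longrightarrow> \<theta> < 1 \<Longrightarrow> m \<le> n \<Longrightarrow> le \<theta> n \<le> le \<theta> m"
  unfolding lazy_energy_def using range lazy_base
  by (intro sum_mono mult_left_mono power_decreasing) (auto intro: less_imp_le)

text \<open>The tangent inequality \<open>1 - x \<le> exp (- x)\<close> at
  \<open>x = (1 - \<theta>) * l\<close>, raised to the power \<open>2 * m\<close>.\<close>

lemma lazy_le_cont:
  assumes "1/2 \<le> \<theta>" "\<theta> < 1"
  shows "le \<theta> m \<le> ce ((1 - \<theta>) * m)"
  unfolding lazy_energy_def cont_energy_def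
proof (intro sum_mono mult_left_mono)
  fix l assume l: "l \<in> B"
  have "(1 - (1 - \<theta>) * l) ^ (2 * m) \<le> exp (- ((1 - \<theta>) * l)) ^ (2 * m)"
    using lazy_base[OF l assms] exp_ge_add_one_self[of "- ((1 - \<theta>) * l)"] by (intro power_mono) auto
  also have "\<dots> = exp (- (2 * ((1 - \<theta>) * m) * l))" by (simp add: exp_of_nat_mult[symmetric] mult_ac)
  finally show "(1 - (1 - \<theta>) * l) ^ (2 * m) \<le> exp (- (2 * ((1 - \<theta>) * m) * l))" .
qed (use range in auto)

lemma cont_le_lazy:
  assumes "1/2 < \<theta>" "\<theta> < 1"
  shows "ce (- ln (2 * \<theta> - 1) / 2 * m) \<le> le \<theta> m"
  unfolding lazy_energy_def cont_energy_def
proof (intro sum_mono mult_left_mono)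
  fix l assume l: "l \<in> B"
  let ?c = "- ln (2 * \<theta> - 1) / 2"
  have "exp (- (2 * (?c * m) * l)) = exp (- (?c * l)) ^ (2 * m)" by (simp add: exp_of_nat_mult[symmetric])
  also have "\<dots> \<le> (1 - (1 - \<theta>) * l) ^ (2 * m)"
    using exp_chord[OF assms, of l] range[OF l] by (intro power_mono) auto
  finally show "exp (- (2 * (?c * m) * l)) \<le> (1 - (1 - \<theta>) * l) ^ (2 * m)" .
qed (use range in auto)

lemma cont_energy_tendsto_0: "(ce \<longlongrightarrow> 0) at_top"
proof -
  have "((\<lambda>t. w l * exp (- (2 * t * l))) \<longlongrightarrow> 0) at_top" if "l \<in> B" for l
  proof (rule tendsto_mult_right_zero)
    have "LIM t at_top. (2 * l) * t :> at_top"
      using range[OF that] by (intro filterlim_tendsto_pos_mult_at_top[OF tendsto_const]) (auto intro: filterlim_ident)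
    then have "((\<lambda>t. exp (- ((2 * l) * t))) \<longlongrightarrow> 0) at_top"
      by (intro filterlim_compose[OF exp_at_bot] filterlim_compose[OF filterlim_uminus_at_bot_at_top])
    then show "((\<lambda>t. exp (- (2 * t * l))) \<longlongrightarrow> 0) at_top" by (simp add: mult_ac)
  qed
  then show ?thesis unfolding cont_energy_def[abs_def] by (intro tendsto_null_sum) auto
qed

lemma cont_energy_eventually_le:
  assumes "0 < \<epsilon>"
  obtains t where "t \<ge> 0" "ce t \<le> \<epsilon>"
proof -
  have "eventually (\<lambda>t. ce t < \<epsilon> \<and> t \<ge> 0) at_top"
    using order_tendstoD(2)[OF cont_energy_tendsto_0 assms] eventually_ge_at_top[of 0] by (rule eventually_conj)
  then show ?thesis using that by (auto simp: eventually_at_top_linorder intro: less_imp_le)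
qed

lemma lazy_energy_eventually_le:
  assumes "1/2 \<le> \<theta>" "\<theta> < 1" "0 < \<epsilon>"
  obtains m where "le \<theta> m \<le> \<epsilon>"
proof -
  obtain t where t: "t \<ge> 0" "ce t \<le> \<epsilon>" using cont_energy_eventually_le[OF assms(3)] by blast
  have "t \<le> (1 - \<theta>) * nat \<lceil>t / (1 - \<theta>)\<rceil>"
  proof -
    have "t / (1 - \<theta>) \<le> nat \<lceil>t / (1 - \<theta>)\<rceil>" by linarith
    then show ?thesis using assms by (simp add: field_simps)
  qed
  then have "le \<theta> (nat \<lceil>t / (1 - \<theta>)\<rceil>) \<le> \<epsilon>"
    using lazy_le_cont[OF assms(1,2)] cont_energy_antimono t(2) by (meson order.trans)
  then show ?thesis by (rule that)
qed

text \<open>Markov's inequality: each atom up to \<open>r\<close> retains at least the fraction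
  \<open>exp (- (2 * t * r))\<close> of its mass at time \<open>t\<close>.\<close>

lemma low_mass_le_cont:
  assumes "0 \<le> t"
  shows "lm r \<le> exp (2 * t * r) * ce t"
  unfolding low_mass_def cont_energy_def sum_distrib_left
proof (rule sum_mono)
  fix l assume l: "l \<in> B"
  have "1 \<le> exp (2 * t * r) * exp (- (2 * t * l))" if "l \<le> r"
    using that assms by (simp add: exp_add[symmetric] mult_left_mono)
  then show "(if l \<le> r then w l else 0) \<le> exp (2 * t * r) * (w l * exp (- (2 * t * l)))"
    using range[OF l] mult_left_mono[of 1 "exp (2 * t * r) * exp (- (2 * t * l))" "w l"] by (auto simp: mult_ac)
qed

text \<open>The discrete Markov inequality; the smallness of \<open>r\<close> allows
  \<open>exp_minus_double_le\<close> to bound the retained fraction from below.\<close>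

lemma low_mass_le_lazy:
  assumes "1/2 \<le> \<theta>" "\<theta> < 1" "0 \<le> r" "(1 - \<theta>) * r \<le> 1/2"
  shows "lm r \<le> exp (4 * real m * (1 - \<theta>) * r) * le \<theta> m"
  unfolding low_mass_def lazy_energy_def sum_distrib_left
proof (rule sum_mono)
  fix l assume l: "l \<in> B"
  have "1 \<le> exp (4 * real m * (1 - \<theta>) * r) * (1 - (1 - \<theta>) * l) ^ (2 * m)" if "l \<le> r"
  proof -
    have "exp (- (2 * ((1 - \<theta>) * r))) \<le> 1 - (1 - \<theta>) * r" using assms by (intro exp_minus_double_le) auto
    also have "\<dots> \<le> 1 - (1 - \<theta>) * l" using that assms by (simp add: mult_left_mono)
    finally have "exp (- (2 * ((1 - \<theta>) * r))) ^ (2 * m) \<le> (1 - (1 - \<theta>) * l) ^ (2 * m)"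
      by (rule power_mono) simp
    moreover have "exp (- (2 * ((1 - \<theta>) * r))) ^ (2 * m) = exp (- (4 * real m * (1 - \<theta>) * r))"
      by (simp add: exp_of_nat_mult[symmetric] mult_ac)
    ultimately have "exp (4 * real m * (1 - \<theta>) * r) * exp (- (4 * real m * (1 - \<theta>) * r)) \<le> exp (4 * real m * (1 - \<theta>) * r) * (1 - (1 - \<theta>) * l) ^ (2 * m)"
      by (intro mult_left_mono) auto
    then show ?thesis by (simp add: exp_minus)
  qed
  then show "(if l \<le> r then w l else 0) \<le> exp (4 * real m * (1 - \<theta>) * r) * (w l * (1 - (1 - \<theta>) * l) ^ (2 * m))"
    using range[OF l] mult_left_mono[of 1 "exp (4 * real m * (1 - \<theta>) * r) * (1 - (1 - \<theta>) * l) ^ (2 * m)" "w l"]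
    by (auto simp: mult_ac power_mult)
qed

text \<open>Atoms up to \<open>r\<close> contribute at most their mass; those above \<open>r\<close>
  lose at least the factor \<open>exp (- (2 * s * r))\<close> during the extra time
  \<open>s\<close>.\<close>

lemma cont_energy_split:
  assumes "0 \<le> t" "0 \<le> s"
  shows "ce (t + s) \<le> lm r + exp (- (2 * s * r)) * ce t"
  unfolding low_mass_def cont_energy_def sum_distrib_left sum.distrib[symmetric]
proof (rule sum_mono)
  fix l assume l: "l \<in> B"
  have eq: "exp (- (2 * (t + s) * l)) = exp (- (2 * s * l)) * exp (- (2 * t * l))"
    by (simp add: exp_add[symmetric] algebra_simps)
  show "w l * exp (- (2 * (t + s) * l)) \<le> (if l \<le> r then w l else 0) + exp (- (2 * s * r)) * (w l * exp (- (2 * t * l)))"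
  proof (cases "l \<le> r")
    case True
    have "w l * exp (- (2 * (t + s) * l)) \<le> w l" using range[OF l] assms by (intro mult_left_le) auto
    then show ?thesis using True range[OF l] by (simp add: add_increasing2)
  next
    case False
    then have "exp (- (2 * s * l)) \<le> exp (- (2 * s * r))" using assms by (simp add: mult_left_mono)
    then show ?thesis unfolding eq using False range[OF l] by (simp add: mult_left_mono mult_ac)
  qed
qed

lemma lazy_energy_split:
  assumes "1/2 \<le> \<theta>" "\<theta> < 1"
  shows "le \<theta> (m + k) \<le> lm r + exp (- (2 * (1 - \<theta>) * k * r)) * le \<theta> m"
  unfolding low_mass_def lazy_energy_def sum_distrib_left sum.distrib[symmetric]
proof (rule sum_mono)
  fix l assume l: "l \<in> B"
  note b = lazy_base[OF l assms]
  let ?b = "1 - (1 - \<theta>) * l"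
  have eq: "?b ^ (2 * (m + k)) = ?b ^ (2 * k) * ?b ^ (2 * m)" by (simp add: power_add[symmetric] algebra_simps)
  show "w l * ?b ^ (2 * (m + k)) \<le> (if l \<le> r then w l else 0) + exp (- (2 * (1 - \<theta>) * k * r)) * (w l * ?b ^ (2 * m))"
  proof (cases "l \<le> r")
    case True
    have "w l * ?b ^ (2 * (m + k)) \<le> w l" using range[OF l] b by (intro mult_left_le power_le_one) auto
    then show ?thesis using True range[OF l] b by (simp add: add_increasing2)
  next
    case False
    have "?b ^ (2 * k) \<le> exp (- ((1 - \<theta>) * l)) ^ (2 * k)"
      using b exp_ge_add_one_self[of "- ((1 - \<theta>) * l)"] by (intro power_mono) auto
    also have "\<dots> = exp (- (2 * (1 - \<theta>) * k * l))" by (simp add: exp_of_nat_mult[symmetric] mult_ac)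
    also have "\<dots> \<le> exp (- (2 * (1 - \<theta>) * k * r))" using False assms by (simp add: mult_left_mono)
    finally have "?b ^ (2 * k) * (w l * ?b ^ (2 * m)) \<le> exp (- (2 * (1 - \<theta>) * k * r)) * (w l * ?b ^ (2 * m))"
      using range[OF l] b by (intro mult_right_mono mult_nonneg_nonneg) auto
    then show ?thesis unfolding eq using False by (simp add: mult_ac)
  qed
qed

text \<open>Cauchy-Schwarz after splitting \<open>exp (- (2 * t * l))\<close> into factors belonging
  to \<open>t - s\<close> and \<open>t + s\<close>.\<close>

lemma cont_energy_log_convex: "(ce t)\<^sup>2 \<le> ce (t - s) * ce (t + s)"
proof -
  have prod: "ce t = (\<Sum>l\<in>B. (sqrt (w l) * exp (- ((t - s) * l))) * (sqrt (w l) * exp (- ((t + s) * l))))"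
    unfolding cont_energy_def
  proof (rule sum.cong)
    fix l assume "l \<in> B"
    then have "w l = sqrt (w l) * sqrt (w l)" using range by simp
    then show "w l * exp (- (2 * t * l)) = (sqrt (w l) * exp (- ((t - s) * l))) * (sqrt (w l) * exp (- ((t + s) * l)))"
      by (simp add: exp_add[symmetric] algebra_simps)
  qed simp
  have sq: "ce u = (\<Sum>l\<in>B. (sqrt (w l) * exp (- (u * l)))\<^sup>2)" for u
    unfolding cont_energy_def using range by (intro sum.cong) (auto simp: power_mult_distrib exp_double[symmetric] mult.assoc)
  show ?thesis unfolding prod sq[of "t - s"] sq[of "t + s"] by (rule Cauchy_Schwarz_ineq_sum)
qed

lemma lazy_energy_log_convex:
  assumes "k \<le> m"
  shows "(le \<theta> m)\<^sup>2 \<le> le \<theta> (m - k) * le \<theta> (m + k)"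
proof -
  let ?b = "\<lambda>l. 1 - (1 - \<theta>) * l"
  have prod: "le \<theta> m = (\<Sum>l\<in>B. (sqrt (w l) * ?b l ^ (m - k)) * (sqrt (w l) * ?b l ^ (m + k)))"
    unfolding lazy_energy_def
  proof (rule sum.cong)
    fix l assume "l \<in> B"
    then have "w l = sqrt (w l) * sqrt (w l)" using range by simp
    moreover have "?b l ^ (2 * m) = ?b l ^ (m - k) * ?b l ^ (m + k)"
      using assms by (simp add: power_add[symmetric] mult_2)
    moreover have "(u * X) * (u * Y) = (u * u) * (X * Y)" for u X Y :: real by (simp only: ac_simps)
    ultimately show "w l * ?b l ^ (2 * m) = (sqrt (w l) * ?b l ^ (m - k)) * (sqrt (w l) * ?b l ^ (m + k))"
      by simp
  qed simp
  have sq: "le \<theta> u = (\<Sum>l\<in>B. (sqrt (w l) * ?b l ^ u)\<^sup>2)" for u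
    unfolding lazy_energy_def using range
    by (intro sum.cong) (auto simp: power_mult_distrib power_even_eq)
  show ?thesis unfolding prod sq[of "m - k"] sq[of "m + k"] by (rule Cauchy_Schwarz_ineq_sum)
qed

text \<open>Bounds the jump of the discrete energy, which in general steps over the level 1 without
  attaining it.\<close>

lemma lazy_energy_Suc_ge:
  assumes "1/2 \<le> \<theta>" "\<theta> < 1"
  shows "(2 * \<theta> - 1)\<^sup>2 * le \<theta> m \<le> le \<theta> (Suc m)"
  unfolding lazy_energy_def sum_distrib_left
proof (rule sum_mono)
  fix l assume l: "l \<in> B"
  have "(2 * \<theta> - 1)\<^sup>2 \<le> (1 - (1 - \<theta>) * l)\<^sup>2" using lazy_base[OF l assms] assms by (intro power_mono) auto
  then have "(2 * \<theta> - 1)\<^sup>2 * (w l * (1 - (1 - \<theta>) * l) ^ (2 * m)) \<le> (1 - (1 - \<theta>) * l)\<^sup>2 * (w l * (1 - (1 - \<theta>) * l) ^ (2 * m))"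
    using range[OF l] by (intro mult_right_mono) (auto simp: power_mult)
  then show "(2 * \<theta> - 1)\<^sup>2 * (w l * (1 - (1 - \<theta>) * l) ^ (2 * m)) \<le> w l * (1 - (1 - \<theta>) * l) ^ (2 * Suc m)"
    by (simp add: power_add mult_ac power2_eq_square)
qed

lemma cont_energy_eq_1:
  assumes "1 \<le> ce 0"
  obtains t where "t \<ge> 0" "ce t = 1"
proof -
  obtain u where u: "u \<ge> 0" "ce u \<le> 1" using cont_energy_eventually_le[of 1] by auto
  have "continuous_on {0..u} ce" unfolding cont_energy_def[abs_def] by (intro continuous_intros)
  then show ?thesis using IVT2'[of ce u 1 0] assms u that by auto
qed

section \<open>Mixing times of a single spectral measure\<close>

lemma lazy_time_le: "sqrt (le \<theta> m) \<le> \<epsilon> \<Longrightarrow> lazy_time B w \<theta> \<epsilon> \<le> m"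
  unfolding lazy_time_def by (rule Least_le)

lemma lazy_time_attained:
  assumes "1/2 \<le> \<theta>" "\<theta> < 1" "0 < \<epsilon>"
  shows "sqrt (le \<theta> (lazy_time B w \<theta> \<epsilon>)) \<le> \<epsilon>"
proof -
  obtain m where "le \<theta> m \<le> \<epsilon>\<^sup>2" using lazy_energy_eventually_le[OF assms(1,2), of "\<epsilon>\<^sup>2"] assms by auto
  then have "sqrt (le \<theta> m) \<le> \<epsilon>" using assms by (simp add: real_le_lsqrt lazy_energy_nonneg)
  then show ?thesis unfolding lazy_time_def by (rule LeastI)
qed

lemma lazy_time_gt:
  assumes "1/2 \<le> \<theta>" "\<theta> < 1" "0 < \<epsilon>" "\<epsilon> < sqrt (le \<theta> m)"
  shows "m < lazy_time B w \<theta> \<epsilon>"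
proof (rule ccontr)
  assume "\<not> m < lazy_time B w \<theta> \<epsilon>"
  then have "sqrt (le \<theta> m) \<le> sqrt (le \<theta> (lazy_time B w \<theta> \<epsilon>))" using lazy_energy_antimono[OF assms(1,2)] by simp
  then show False using lazy_time_attained[OF assms(1-3)] assms(4) by linarith
qed

lemma cont_time_le:
  assumes "0 \<le> t" "sqrt (ce t) \<le> \<epsilon>"
  shows "cont_time B w \<epsilon> \<le> t"
  unfolding cont_time_def using assms by (intro cInf_lower bdd_belowI[of _ 0]) auto

lemma cont_time_approx:
  assumes "0 < \<epsilon>" "0 < \<delta>"
  obtains t where "0 \<le> t" "t < cont_time B w \<epsilon> + \<delta>" "sqrt (ce t) \<le> \<epsilon>"
proof -
  obtain t where t: "t \<ge> 0" "ce t \<le> \<epsilon>\<^sup>2" using cont_energy_eventually_le[of "\<epsilon>\<^sup>2"] assms by auto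
  then have "sqrt (ce t) \<le> \<epsilon>" using assms by (simp add: real_le_lsqrt cont_energy_nonneg)
  then have "{t. t \<ge> 0 \<and> sqrt (ce t) \<le> \<epsilon>} \<noteq> {}" using t by auto
  then show ?thesis using cInf_lessD[of "{t. t \<ge> 0 \<and> sqrt (ce t) \<le> \<epsilon>}" "cont_time B w \<epsilon> + \<delta>"] assms that
    unfolding cont_time_def by auto
qed

text \<open>By \<open>cont_le_lazy\<close>, the continuous energy is below the level at
  \<open>- ln (2 * \<theta> - 1) / 2\<close> times the lazy mixing time.\<close>

lemma cont_time_le_lazy_time:
  assumes "1/2 < \<theta>" "\<theta> < 1" "0 < \<epsilon>"
  shows "cont_time B w \<epsilon> \<le> - ln (2 * \<theta> - 1) / 2 * lazy_time B w \<theta> \<epsilon>"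
proof (rule cont_time_le)
  have "ln (2 * \<theta> - 1) \<le> 0" using assms by simp
  then show "0 \<le> - ln (2 * \<theta> - 1) / 2 * lazy_time B w \<theta> \<epsilon>" by (intro mult_nonneg_nonneg) auto
  have "sqrt (ce (- ln (2 * \<theta> - 1) / 2 * lazy_time B w \<theta> \<epsilon>)) \<le> sqrt (le \<theta> (lazy_time B w \<theta> \<epsilon>))"
    by (intro real_sqrt_le_mono cont_le_lazy assms)
  also have "\<dots> \<le> \<epsilon>" using assms by (intro lazy_time_attained) auto
  finally show "sqrt (ce (- ln (2 * \<theta> - 1) / 2 * lazy_time B w \<theta> \<epsilon>)) \<le> \<epsilon>" .
qed

text \<open>The additive 2 pays 1 for a near-minimizer of the infimum and less than 1 for rounding
  \<open>t / (1 - \<theta>)\<close> up to an integer.\<close>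

lemma lazy_time_le_cont_time:
  assumes "1/2 \<le> \<theta>" "\<theta> < 1" "0 < \<epsilon>"
  shows "(1 - \<theta>) * lazy_time B w \<theta> \<epsilon> \<le> cont_time B w \<epsilon> + 2"
proof -
  obtain t where t: "0 \<le> t" "t < cont_time B w \<epsilon> + 1" "sqrt (ce t) \<le> \<epsilon>"
    using cont_time_approx[OF assms(3), of 1] by auto
  define m where "m = nat \<lceil>t / (1 - \<theta>)\<rceil>"
  have "t / (1 - \<theta>) \<ge> 0" using t assms by simp
  then have "t / (1 - \<theta>) \<le> m" "m \<le> t / (1 - \<theta>) + 1" unfolding m_def by linarith+
  then have m: "t \<le> (1 - \<theta>) * m" "(1 - \<theta>) * m \<le> t + (1 - \<theta>)" using assms by (auto simp: field_simps)
  have "sqrt (le \<theta> m) \<le> \<epsilon>"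
    using lazy_le_cont[OF assms(1,2), of m] cont_energy_antimono[OF m(1)] t(3)
    by (meson order.trans real_sqrt_le_mono)
  then have "(1 - \<theta>) * lazy_time B w \<theta> \<epsilon> \<le> (1 - \<theta>) * m"
    using assms by (intro mult_left_mono) (auto intro: lazy_time_le)
  then show ?thesis using m t assms by linarith
qed

end

subsection \<open>Cutoff for families of spectral measures\<close>

text \<open>The cut-off parameter \<open>M\<close> is fixed first, to make the exponential small;
  only then does \<open>n\<close> tend to infinity.\<close>

lemma tendsto_0_by_split:
  fixes x :: "nat \<Rightarrow> real"
  assumes x: "\<And>n. 0 \<le> x n" and "0 < \<kappa>"
    and split: "\<And>M. 0 < M \<Longrightarrow> eventually (\<lambda>n. x n \<le> y M n + exp (- (\<kappa> * M))) sequentially"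
    and y: "\<And>M. 0 < M \<Longrightarrow> y M \<longlonglongrightarrow> 0"
  shows "x \<longlonglongrightarrow> 0"
proof (rule LIMSEQ_I)
  fix \<epsilon> :: real assume \<epsilon>: "0 < \<epsilon>"
  define M where "M = max 1 (ln (2 / \<epsilon>) / \<kappa>)"
  have M: "0 < M" "ln (2 / \<epsilon>) \<le> \<kappa> * M" using assms(2) by (auto simp: M_def field_simps max_def)
  have "exp (- (\<kappa> * M)) \<le> exp (- ln (2 / \<epsilon>))" using M by simp
  also have "\<dots> = \<epsilon> / 2" using \<epsilon> by (simp add: exp_minus)
  finally have e: "exp (- (\<kappa> * M)) \<le> \<epsilon> / 2" .
  have "eventually (\<lambda>n. y M n < \<epsilon> / 2) sequentially"
    using order_tendstoD(2)[OF y[OF M(1)], of "\<epsilon> / 2"] \<epsilon> by simp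
  then have "eventually (\<lambda>n. norm (x n - 0) < \<epsilon>) sequentially"
    using split[OF M(1)]
  proof eventually_elim
    case (elim n)
    then show ?case using e x[of n] by simp
  qed
  then show "\<exists>no. \<forall>n\<ge>no. norm (x n - 0) < \<epsilon>" by (simp add: eventually_sequentially)
qed

lemma at_top_by_product_ge:
  fixes x :: "nat \<Rightarrow> real"
  assumes "0 < \<delta>" and xy: "eventually (\<lambda>n. \<delta> \<le> x n * y n) sequentially"
    and "\<And>n. 0 \<le> y n" and y: "y \<longlonglongrightarrow> 0"
  shows "filterlim x at_top sequentially"
  unfolding filterlim_at_top_gt[where c = 0]
proof (intro allI impI)
  fix Z :: real assume Z: "0 < Z"
  have "eventually (\<lambda>n. y n < \<delta> / Z) sequentially"
    using order_tendstoD(2)[OF y, of "\<delta> / Z"] assms(1) Z by simp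
  then show "eventually (\<lambda>n. Z \<le> x n) sequentially"
    using xy
  proof eventually_elim
    case (elim n)
    show ?case
    proof (rule ccontr)
      assume "\<not> Z \<le> x n"
      then have "x n * y n \<le> Z * y n" using assms(3) by (intro mult_right_mono) auto
      also have "\<dots> < \<delta>" using elim Z by (simp add: field_simps)
      finally show False using elim by simp
    qed
  qed
qed

lemma sqrt_tendsto_0_iff:
  assumes "\<And>n. 0 \<le> x n"
  shows "((\<lambda>n. sqrt (x n)) \<longlonglongrightarrow> 0) \<longleftrightarrow> x \<longlonglongrightarrow> 0"
proof
  assume "(\<lambda>n. sqrt (x n)) \<longlonglongrightarrow> 0"
  then have "(\<lambda>n. (sqrt (x n))\<^sup>2) \<longlonglongrightarrow> 0\<^sup>2" by (rule tendsto_power)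
  then show "x \<longlonglongrightarrow> 0" using assms by simp
next
  assume "x \<longlonglongrightarrow> 0"
  then show "(\<lambda>n. sqrt (x n)) \<longlonglongrightarrow> 0" using tendsto_real_sqrt by fastforce
qed

lemma sqrt_at_top_iff:
  assumes "\<And>n. 0 \<le> x n"
  shows "filterlim (\<lambda>n. sqrt (x n)) at_top sequentially \<longleftrightarrow> filterlim x at_top sequentially"
proof
  assume "filterlim (\<lambda>n. sqrt (x n)) at_top sequentially"
  then have "filterlim (\<lambda>n. sqrt (x n) * sqrt (x n)) at_top sequentially"
    by (intro filterlim_at_top_mult_at_top)
  then show "filterlim x at_top sequentially" using assms by simp
qed (rule filterlim_compose[OF sqrt_at_top])

text \<open>The growth of the energy at time 0 forces the energy to start above the level 1 for all
  large \<open>n\<close>, so that the crossing of this level can serve as the time scale.\<close>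

locale spectral_family =
  fixes B :: "nat \<Rightarrow> real set" and w :: "nat \<Rightarrow> real \<Rightarrow> real"
  assumes sp: "\<And>n. spectral (B n) (w n)"
    and big: "filterlim (\<lambda>n. cont_energy (B n) (w n) 0) at_top sequentially"
begin

abbreviation "ce n \<equiv> cont_energy (B n) (w n)"
abbreviation "le \<theta> n \<equiv> lazy_energy (B n) (w n) \<theta>"
abbreviation "lm n \<equiv> low_mass (B n) (w n)"

text \<open>Phrased with squared distances; the square root preserves both limits 0 and
  infinity.\<close>

definition cont_cutoff_times :: "(nat \<Rightarrow> real) \<Rightarrow> bool" where
  "cont_cutoff_times t \<longleftrightarrow> (\<forall>n. 0 < t n) \<and> (\<forall>a. 0 < a \<and> a < 1 \<longrightarrow>
     (\<lambda>n. ce n ((1 + a) * t n)) \<longlonglongrightarrow> 0 \<and> filterlim (\<lambda>n. ce n ((1 - a) * t n)) at_top sequentially)"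

definition lazy_cutoff_times :: "real \<Rightarrow> (nat \<Rightarrow> real) \<Rightarrow> bool" where
  "lazy_cutoff_times \<theta> s \<longleftrightarrow> (\<forall>n. 0 < s n) \<and> (\<forall>a. 0 < a \<and> a < 1 \<longrightarrow>
     (\<lambda>n. le \<theta> n (nat \<lceil>(1 + a) * s n\<rceil>)) \<longlonglongrightarrow> 0 \<and>
     filterlim (\<lambda>n. le \<theta> n (nat \<lfloor>(1 - a) * s n\<rfloor>)) at_top sequentially)"

lemma cont_cutoff_timesD:
  assumes "cont_cutoff_times t" "0 < a" "a < 1"
  shows "(\<lambda>n. ce n ((1 + a) * t n)) \<longlonglongrightarrow> 0" "filterlim (\<lambda>n. ce n ((1 - a) * t n)) at_top sequentially"
  using assms by (auto simp: cont_cutoff_times_def)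

lemma lazy_cutoff_timesD:
  assumes "lazy_cutoff_times \<theta> s" "0 < a" "a < 1"
  shows "(\<lambda>n. le \<theta> n (nat \<lceil>(1 + a) * s n\<rceil>)) \<longlonglongrightarrow> 0"
    "filterlim (\<lambda>n. le \<theta> n (nat \<lfloor>(1 - a) * s n\<rfloor>)) at_top sequentially"
  using assms by (auto simp: lazy_cutoff_times_def)

lemma eventually_cont_cutoff_times:
  assumes "cont_cutoff_times t" "0 < a" "a < 1" "0 < \<epsilon>"
  shows "eventually (\<lambda>n. ce n ((1 + a) * t n) < \<epsilon>) sequentially"
    "eventually (\<lambda>n. \<epsilon> < ce n ((1 - a) * t n)) sequentially"
  using order_tendstoD(2)[OF cont_cutoff_timesD(1)[OF assms(1-3)] assms(4)]
    cont_cutoff_timesD(2)[OF assms(1-3)] by (auto simp: filterlim_at_top_dense)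

lemma eventually_lazy_cutoff_times:
  assumes "lazy_cutoff_times \<theta> s" "0 < a" "a < 1" "0 < \<epsilon>"
  shows "eventually (\<lambda>n. le \<theta> n (nat \<lceil>(1 + a) * s n\<rceil>) < \<epsilon>) sequentially"
    "eventually (\<lambda>n. \<epsilon> < le \<theta> n (nat \<lfloor>(1 - a) * s n\<rfloor>)) sequentially"
  using order_tendstoD(2)[OF lazy_cutoff_timesD(1)[OF assms(1-3)] assms(4)]
    lazy_cutoff_timesD(2)[OF assms(1-3)] by (auto simp: filterlim_at_top_dense)

lemma cont_cutoff_times_at_top:
  assumes cut: "cont_cutoff_times t" and "0 < \<epsilon>"
    and top: "filterlim (\<lambda>n. cont_time (B n) (w n) \<epsilon>) at_top sequentially"
  shows "filterlim t at_top sequentially"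
proof -
  have "eventually (\<lambda>n. cont_time (B n) (w n) \<epsilon> \<le> (1 + 1/2) * t n) sequentially"
  proof -
    have "eventually (\<lambda>n. ce n ((1 + 1/2) * t n) < \<epsilon>\<^sup>2) sequentially"
      using assms(2) by (intro eventually_cont_cutoff_times(1)[OF cut]) auto
    then show ?thesis
    proof eventually_elim
      case (elim n)
      then have "sqrt (ce n ((1 + 1/2) * t n)) \<le> \<epsilon>" using assms(2) by (simp add: real_le_lsqrt spectral.cont_energy_nonneg[OF sp])
      then show ?case
        using cut by (intro spectral.cont_time_le[OF sp]) (auto simp: cont_cutoff_times_def less_imp_le)
    qed
  qed
  then have "filterlim (\<lambda>n. (1 + 1/2) * t n) at_top sequentially" by (rule filterlim_at_top_mono[OF top])
  then have "filterlim (\<lambda>n. (2/3) * ((1 + 1/2) * t n)) at_top sequentially"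
    by (rule filterlim_tendsto_pos_mult_at_top[OF tendsto_const, rotated]) simp
  then show ?thesis by simp
qed

lemma lazy_cutoff_times_at_top:
  assumes cut: "lazy_cutoff_times \<theta> s" and "0 < \<epsilon>"
    and top: "filterlim (\<lambda>n. lazy_time (B n) (w n) \<theta> \<epsilon>) at_top sequentially"
  shows "filterlim s at_top sequentially"
proof -
  have "eventually (\<lambda>n. real (lazy_time (B n) (w n) \<theta> \<epsilon>) \<le> 1 + (3/2) * s n) sequentially"
  proof -
    have "eventually (\<lambda>n. le \<theta> n (nat \<lceil>(1 + 1/2) * s n\<rceil>) < \<epsilon>\<^sup>2) sequentially"
      using assms(2) by (intro eventually_lazy_cutoff_times(1)[OF cut]) auto
    then show ?thesis
    proof eventually_elim
      case (elim n)
      then have "sqrt (le \<theta> n (nat \<lceil>(1 + 1/2) * s n\<rceil>)) \<le> \<epsilon>"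
        using assms(2) by (simp add: real_le_lsqrt spectral.lazy_energy_nonneg[OF sp])
      then have "lazy_time (B n) (w n) \<theta> \<epsilon> \<le> nat \<lceil>(1 + 1/2) * s n\<rceil>" by (rule spectral.lazy_time_le[OF sp])
      moreover have "0 < s n" using cut by (simp add: lazy_cutoff_times_def)
      moreover have "(1 + 1/2) * s n = s n + s n / 2" by simp
      ultimately show ?case by linarith
    qed
  qed
  then have "filterlim (\<lambda>n. 1 + (3/2) * s n) at_top sequentially"
    by (rule filterlim_at_top_mono[OF filterlim_compose[OF filterlim_real_sequentially top]])
  then have "filterlim (\<lambda>n. -1 + (1 + (3/2) * s n)) at_top sequentially"
    by (rule filterlim_tendsto_add_at_top[OF tendsto_const])
  then have "filterlim (\<lambda>n. (2/3) * (-1 + (1 + (3/2) * s n))) at_top sequentially"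
    by (rule filterlim_tendsto_pos_mult_at_top[OF tendsto_const, rotated]) simp
  then show ?thesis by simp
qed

text \<open>Splitting at \<open>M / t n\<close> makes the energy after \<open>t n\<close> tend to 0.
  Log-convexity around \<open>t n\<close>, where the energy is 1, then forces divergence before
  it.\<close>

lemma cont_cutoff_of_low_mass:
  assumes t: "\<And>n. 0 < t n" and t1: "eventually (\<lambda>n. ce n (t n) = 1) sequentially"
    and low: "\<And>M. 0 < M \<Longrightarrow> (\<lambda>n. lm n (M / t n)) \<longlonglongrightarrow> 0"
  shows "cont_cutoff_times t"
  unfolding cont_cutoff_times_def
proof (intro conjI allI impI)
  fix a :: real assume a: "0 < a \<and> a < 1"
  show lim: "(\<lambda>n. ce n ((1 + a) * t n)) \<longlonglongrightarrow> 0"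
  proof (rule tendsto_0_by_split[where \<kappa> = "2 * a" and y = "\<lambda>M n. lm n (M / t n)"])
    fix M :: real assume "0 < M"
    show "eventually (\<lambda>n. ce n ((1 + a) * t n) \<le> lm n (M / t n) + exp (- (2 * a * M))) sequentially"
      using t1
    proof eventually_elim
      case (elim n)
      then show ?case using spectral.cont_energy_split[OF sp, of "t n" "a * t n" n "M / t n"] a t[of n]
        by (simp add: algebra_simps)
    qed
  qed (use a low spectral.cont_energy_nonneg[OF sp] in auto)
  show "filterlim (\<lambda>n. ce n ((1 - a) * t n)) at_top sequentially"
  proof (rule at_top_by_product_ge[OF _ _ _ lim, of 1])
    show "eventually (\<lambda>n. 1 \<le> ce n ((1 - a) * t n) * ce n ((1 + a) * t n)) sequentially"
      using t1
    proof eventually_elim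
      case (elim n)
      then show ?case using spectral.cont_energy_log_convex[OF sp, of n "t n" "a * t n"]
        by (simp add: algebra_simps)
    qed
  qed (use spectral.cont_energy_nonneg[OF sp] in auto)
qed (rule t)

text \<open>The discrete energy need not equal 1 at \<open>m n\<close>, but crossing the level
  between \<open>m n - 1\<close> and \<open>m n\<close> keeps it at least
  \<open>(2 * \<theta> - 1)\<^sup>2\<close> there, so log-convexity still bounds the product of the
  two sides from below.\<close>

lemma lazy_cutoff_of_low_mass:
  fixes m :: "nat \<Rightarrow> nat"
  assumes \<theta>: "1/2 < \<theta>" "\<theta> < 1"
    and m: "\<And>n. 0 < m n" and m1: "eventually (\<lambda>n. le \<theta> n (m n) \<le> 1 \<and> 1 \<le> le \<theta> n (m n - 1)) sequentially"
    and low: "\<And>M. 0 < M \<Longrightarrow> (\<lambda>n. lm n (M / m n)) \<longlonglongrightarrow> 0"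
  shows "lazy_cutoff_times \<theta> (\<lambda>n. real (m n))"
  unfolding lazy_cutoff_times_def
proof (intro conjI allI impI)
  fix a :: real assume a: "0 < a \<and> a < 1"
  \<comment> \<open>One shift serves both sides: as \<open>m n\<close> is an integer, rounding up
    \<open>(1 + a) * m n\<close> and rounding down \<open>(1 - a) * m n\<close> give
    \<open>m n + k n\<close> and \<open>m n - k n\<close>.\<close>
  define k where "k = (\<lambda>n. nat \<lceil>a * m n\<rceil>)"
  have k: "a * m n \<le> k n" "k n \<le> m n" "nat \<lceil>(1 + a) * m n\<rceil> = m n + k n" "nat \<lfloor>(1 - a) * m n\<rfloor> = m n - k n" for n
  proof -
    define x where "x = a * real (m n)"
    have "x \<le> 1 * real (m n)" unfolding x_def using a by (intro mult_right_mono) auto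
    then have x: "0 \<le> x" "x \<le> m n" using a by (auto simp: x_def)
    have kx: "k n = nat \<lceil>x\<rceil>" by (simp add: k_def x_def)
    have "(1 + a) * m n = x + m n" "(1 - a) * m n = m n - x" by (simp_all add: x_def algebra_simps)
    moreover have "nat \<lceil>x + m n\<rceil> = m n + nat \<lceil>x\<rceil>" "nat \<lfloor>m n - x\<rfloor> = m n - nat \<lceil>x\<rceil>"
      using x by linarith+
    ultimately show "nat \<lceil>(1 + a) * m n\<rceil> = m n + k n" "nat \<lfloor>(1 - a) * m n\<rfloor> = m n - k n"
      by (simp_all add: kx)
    show "a * m n \<le> k n" "k n \<le> m n" using x unfolding kx x_def[symmetric] by linarith+
  qed
  show lim: "(\<lambda>n. le \<theta> n (nat \<lceil>(1 + a) * m n\<rceil>)) \<longlonglongrightarrow> 0"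
  proof (rule tendsto_0_by_split[where \<kappa> = "2 * (1 - \<theta>) * a" and y = "\<lambda>M n. lm n (M / m n)"])
    fix M :: real assume M: "0 < M"
    show "eventually (\<lambda>n. le \<theta> n (nat \<lceil>(1 + a) * m n\<rceil>) \<le> lm n (M / m n) + exp (- (2 * (1 - \<theta>) * a * M))) sequentially"
      using m1
    proof eventually_elim
      case (elim n)
      have "2 * (1 - \<theta>) * M * a \<le> 2 * (1 - \<theta>) * M * (k n / m n)"
        using k(1)[of n] m[of n] M \<theta> by (intro mult_left_mono) (auto simp: field_simps)
      then have "exp (- (2 * (1 - \<theta>) * k n * (M / m n))) \<le> exp (- (2 * (1 - \<theta>) * a * M))"
        by (simp add: algebra_simps)
      then have "exp (- (2 * (1 - \<theta>) * k n * (M / m n))) * le \<theta> n (m n) \<le> exp (- (2 * (1 - \<theta>) * a * M)) * 1"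
        using elim by (intro mult_mono) (auto simp: spectral.lazy_energy_nonneg[OF sp])
      then show ?case using spectral.lazy_energy_split[OF sp, of \<theta> n "m n" "k n" "M / m n"] \<theta>
        by (simp add: k(3))
    qed
  qed (use a \<theta> low spectral.lazy_energy_nonneg[OF sp] in auto)
  show "filterlim (\<lambda>n. le \<theta> n (nat \<lfloor>(1 - a) * m n\<rfloor>)) at_top sequentially"
  proof (rule at_top_by_product_ge[OF _ _ _ lim, of "((2 * \<theta> - 1)\<^sup>2)\<^sup>2"])
    show "eventually (\<lambda>n. ((2 * \<theta> - 1)\<^sup>2)\<^sup>2 \<le> le \<theta> n (nat \<lfloor>(1 - a) * m n\<rfloor>) * le \<theta> n (nat \<lceil>(1 + a) * m n\<rceil>)) sequentially"
      using m1
    proof eventually_elim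
      case (elim n)
      have "(2 * \<theta> - 1)\<^sup>2 * 1 \<le> (2 * \<theta> - 1)\<^sup>2 * le \<theta> n (m n - 1)" using elim by (intro mult_left_mono) auto
      also have "\<dots> \<le> le \<theta> n (m n)"
        using spectral.lazy_energy_Suc_ge[OF sp, of \<theta> n "m n - 1"] \<theta> m[of n] by simp
      finally have "((2 * \<theta> - 1)\<^sup>2)\<^sup>2 \<le> (le \<theta> n (m n))\<^sup>2" by (intro power_mono) auto
      also have "\<dots> \<le> le \<theta> n (m n - k n) * le \<theta> n (m n + k n)"
        by (rule spectral.lazy_energy_log_convex[OF sp k(2)])
      finally show ?case by (simp add: k(3,4))
    qed
  qed (use \<theta> spectral.lazy_energy_nonneg[OF sp] in auto)
qed (use m in simp)

text \<open>The criterion \<open>cont_cutoff_of_low_mass\<close> is applied at the crossing times of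
  level 1; vanishing lazy energy shortly after \<open>s n\<close> bounds the low mass at scale
  \<open>1 / s n\<close>, and \<open>t n\<close> is at least a fixed multiple of
  \<open>s n\<close>.\<close>

lemma cont_cutoff_of_lazy_cutoff:
  assumes \<theta>: "1/2 \<le> \<theta>" "\<theta> < 1" and cut: "lazy_cutoff_times \<theta> s" and top: "filterlim s at_top sequentially"
  obtains t where "cont_cutoff_times t"
proof -
  \<comment> \<open>The default 1 keeps the times positive for those finitely many \<open>n\<close>
    at which no positive crossing time may exist.\<close>
  define t where "t = (\<lambda>n. if \<exists>u>0. ce n u = 1 then SOME u. u > 0 \<and> ce n u = 1 else 1)"
  have t: "0 < t n" for n unfolding t_def by (auto intro: someI2_ex)
  have t1: "eventually (\<lambda>n. ce n (t n) = 1) sequentially"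
    using big[unfolded filterlim_at_top_dense, rule_format, of 1]
  proof eventually_elim
    case (elim n)
    then obtain u where u: "u \<ge> 0" "ce n u = 1" using spectral.cont_energy_eq_1[OF sp, of n] by auto
    then have "u \<noteq> 0" using elim by auto
    then have "\<exists>u>0. ce n u = 1" using u by (intro exI[of _ u]) auto
    then show ?case unfolding t_def by (auto intro: someI2_ex)
  qed
  have half: "0 < (1/2 :: real)" "1/2 < (1::real)" by simp_all
  \<comment> \<open>At half the lazy cutoff time the lazy energy exceeds 1, hence so does the
    continuous energy at \<open>1 - \<theta>\<close> times that step. For
    \<open>s n \<ge> 4\<close>, rounding \<open>s n / 2\<close> down leaves at least
    \<open>s n / 4\<close>.\<close>
  have ge: "eventually (\<lambda>n. (1 - \<theta>) / 4 * s n \<le> t n) sequentially"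
    using t1 eventually_lazy_cutoff_times(2)[OF cut half zero_less_one] top[unfolded filterlim_at_top, rule_format, of 4]
  proof eventually_elim
    case (elim n)
    let ?m = "nat \<lfloor>(1 - 1/2) * s n\<rfloor>"
    have "ce n (t n) < le \<theta> n ?m" using elim by simp
    also have "\<dots> \<le> ce n ((1 - \<theta>) * ?m)" by (rule spectral.lazy_le_cont[OF sp \<theta>])
    finally have "(1 - \<theta>) * ?m < t n" using spectral.cont_energy_antimono[OF sp, of "t n" "(1 - \<theta>) * ?m" n] by linarith
    moreover have "(1 - 1/2) * s n = s n / 2" by simp
    then have "s n / 4 \<le> ?m" using elim by linarith
    then have "(1 - \<theta>) * (s n / 4) \<le> (1 - \<theta>) * ?m" using \<theta> by (intro mult_left_mono) auto
    ultimately show ?case by simp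
  qed
  have "(\<lambda>n. lm n (M / t n)) \<longlonglongrightarrow> 0" if M: "0 < M" for M
  proof -
    define M' where "M' = 4 * M / (1 - \<theta>)"
    have M': "0 < M'" using M \<theta> by (simp add: M'_def)
    \<comment> \<open>\<open>s n \<ge> 2 * (1 - \<theta>) * M'\<close> makes the threshold
      \<open>M' / s n\<close> small enough for \<open>low_mass_le_lazy\<close>, and
      \<open>s n \<ge> 2\<close> bounds the rounded time by \<open>2 * s n\<close>.\<close>
    have bound: "eventually (\<lambda>n. lm n (M / t n) \<le> exp (8 * (1 - \<theta>) * M') * le \<theta> n (nat \<lceil>(1 + 1/2) * s n\<rceil>)) sequentially"
      using ge top[unfolded filterlim_at_top, rule_format, of 2] top[unfolded filterlim_at_top, rule_format, of "2 * (1 - \<theta>) * M'"]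
    proof eventually_elim
      case (elim n)
      let ?m = "nat \<lceil>(1 + 1/2) * s n\<rceil>"
      have "M / t n \<le> M / ((1 - \<theta>) / 4 * s n)" using elim \<theta> M by (intro divide_left_mono) (auto intro!: mult_pos_pos t)
      also have "\<dots> = M' / s n" using \<theta> by (simp add: M'_def field_simps)
      finally have "lm n (M / t n) \<le> lm n (M' / s n)" by (rule spectral.low_mass_mono[OF sp])
      also have "\<dots> \<le> exp (4 * real ?m * (1 - \<theta>) * (M' / s n)) * le \<theta> n ?m"
        using elim M' \<theta> by (intro spectral.low_mass_le_lazy[OF sp]) (auto simp: field_simps)
      also have "\<dots> \<le> exp (8 * (1 - \<theta>) * M') * le \<theta> n ?m"
      proof (rule mult_right_mono)
        have "(1 + 1/2) * s n = s n + s n / 2" by simp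
        then have "real ?m \<le> 2 * s n" using elim by linarith
        then have "4 * (1 - \<theta>) * (M' / s n) * ?m \<le> 4 * (1 - \<theta>) * (M' / s n) * (2 * s n)"
          using elim M' \<theta> by (intro mult_left_mono) auto
        also have "4 * (1 - \<theta>) * (M' / s n) * (2 * s n) = 8 * (1 - \<theta>) * M'" using elim by simp
        also have "4 * (1 - \<theta>) * (M' / s n) * ?m = 4 * real ?m * (1 - \<theta>) * (M' / s n)" by (simp only: ac_simps)
        finally show "exp (4 * real ?m * (1 - \<theta>) * (M' / s n)) \<le> exp (8 * (1 - \<theta>) * M')"
          by (simp only: exp_le_cancel_iff)
      qed (rule spectral.lazy_energy_nonneg[OF sp])
      finally show ?case .
    qed
    have "(\<lambda>n. exp (8 * (1 - \<theta>) * M') * le \<theta> n (nat \<lceil>(1 + 1/2) * s n\<rceil>)) \<longlonglongrightarrow> 0"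
      by (intro tendsto_mult_right_zero lazy_cutoff_timesD(1)[OF cut]) auto
    then show ?thesis
      by (rule tendsto_sandwich[OF _ bound tendsto_const, rotated]) (auto simp: spectral.low_mass_nonneg[OF sp])
  qed
  then show ?thesis using cont_cutoff_of_low_mass[OF t t1] that by blast
qed

lemma lazy_cutoff_of_cont_cutoff:
  assumes \<theta>: "1/2 < \<theta>" "\<theta> < 1" and cut: "cont_cutoff_times t" and top: "filterlim t at_top sequentially"
  obtains s where "lazy_cutoff_times \<theta> s"
proof -
  define c where "c = - ln (2 * \<theta> - 1) / 2"
  have c: "0 < c" using \<theta> by (simp add: c_def)
  have t: "0 < t n" for n using cut by (simp add: cont_cutoff_times_def)
  \<comment> \<open>The first time at level 1 or below, raised to at least 1 so that it is positive
    and \<open>m n - 1\<close> is a genuine predecessor.\<close>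
  define m where "m = (\<lambda>n. max 1 (LEAST m. le \<theta> n m \<le> 1))"
  have m: "0 < m n" for n by (simp add: m_def)
  have le1: "le \<theta> n (m n) \<le> 1" for n
  proof -
    obtain k where "le \<theta> n k \<le> 1" using spectral.lazy_energy_eventually_le[OF sp, of \<theta> 1 n] \<theta> by auto
    then have "le \<theta> n (LEAST m. le \<theta> n m \<le> 1) \<le> 1" by (rule LeastI)
    moreover have "le \<theta> n (m n) \<le> le \<theta> n (LEAST m. le \<theta> n m \<le> 1)"
      using \<theta> by (intro spectral.lazy_energy_antimono[OF sp]) (auto simp: m_def)
    ultimately show ?thesis by simp
  qed
  have half: "0 < (1/2 :: real)" "1/2 < (1::real)" by simp_all
  \<comment> \<open>The continuous energy is at most 1 at \<open>c * m n\<close> by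
    \<open>cont_le_lazy\<close>, but exceeds 1 at \<open>t n / 2\<close>.\<close>
  have ge: "eventually (\<lambda>n. t n / (2 * c) \<le> m n) sequentially"
    using eventually_cont_cutoff_times(2)[OF cut half zero_less_one]
  proof eventually_elim
    case (elim n)
    moreover have "ce n (c * m n) \<le> 1"
      using spectral.cont_le_lazy[OF sp \<theta>, of n "m n"] le1[of n] by (simp add: c_def)
    ultimately have "(1 - 1/2) * t n < c * m n"
      using spectral.cont_energy_antimono[OF sp, of "c * m n" "(1 - 1/2) * t n" n] by linarith
    then show ?case using c by (simp add: field_simps)
  qed
  have m1: "eventually (\<lambda>n. le \<theta> n (m n) \<le> 1 \<and> 1 \<le> le \<theta> n (m n - 1)) sequentially"
    using big[unfolded filterlim_at_top_dense, rule_format, of 1]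
  proof eventually_elim
    case (elim n)
    have "ce n 0 = le \<theta> n 0" by (simp add: cont_energy_def lazy_energy_def)
    then have 0: "\<not> le \<theta> n 0 \<le> 1" using elim by simp
    have "1 \<le> le \<theta> n (m n - 1)"
    proof (cases "m n = 1")
      case True
      then show ?thesis using 0 by simp
    next
      case False
      then have "m n - 1 < (LEAST m. le \<theta> n m \<le> 1)" by (auto simp: m_def)
      then show ?thesis using not_less_Least by fastforce
    qed
    then show ?case using le1 by simp
  qed
  have "(\<lambda>n. lm n (M / m n)) \<longlonglongrightarrow> 0" if M: "0 < M" for M
  proof -
    have bound: "eventually (\<lambda>n. lm n (M / m n) \<le> exp (6 * c * M) * ce n ((1 + 1/2) * t n)) sequentially"
      using ge
    proof eventually_elim
      case (elim n)
      have "M / m n \<le> M / (t n / (2 * c))" using elim c M t[of n] m[of n] by (intro divide_left_mono) auto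
      also have "\<dots> = 2 * c * M / t n" by simp
      finally have "lm n (M / m n) \<le> lm n (2 * c * M / t n)" by (rule spectral.low_mass_mono[OF sp])
      also have "\<dots> \<le> exp (2 * ((1 + 1/2) * t n) * (2 * c * M / t n)) * ce n ((1 + 1/2) * t n)"
        using t[of n] by (intro spectral.low_mass_le_cont[OF sp]) auto
      also have "2 * ((1 + 1/2) * t n) * (2 * c * M / t n) = 6 * c * M" using t[of n] by simp
      finally show ?case .
    qed
    have "(\<lambda>n. exp (6 * c * M) * ce n ((1 + 1/2) * t n)) \<longlonglongrightarrow> 0"
      by (intro tendsto_mult_right_zero cont_cutoff_timesD(1)[OF cut]) auto
    then show ?thesis
      by (rule tendsto_sandwich[OF _ bound tendsto_const, rotated]) (auto simp: spectral.low_mass_nonneg[OF sp])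
  qed
  then show ?thesis using lazy_cutoff_of_low_mass[OF \<theta> m m1] that by blast
qed

text \<open>Divergence at one level passes to the cutoff times \<open>s\<close>; at half of
  \<open>s n\<close> the energy exceeds any prescribed level, which carries divergence over to every
  \<epsilon>.\<close>

lemma lazy_time_at_top:
  assumes \<theta>: "1/2 \<le> \<theta>" "\<theta> < 1" and cut: "lazy_cutoff_times \<theta> s" and "0 < \<epsilon>0"
    and top: "filterlim (\<lambda>n. lazy_time (B n) (w n) \<theta> \<epsilon>0) at_top sequentially" and \<epsilon>: "0 < \<epsilon>"
  shows "filterlim (\<lambda>n. real (lazy_time (B n) (w n) \<theta> \<epsilon>)) at_top sequentially"
proof (rule filterlim_at_top_mono)
  have s: "filterlim s at_top sequentially" by (rule lazy_cutoff_times_at_top[OF cut assms(4) top])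
  then have "filterlim (\<lambda>n. -1 + (1/2) * s n) at_top sequentially"
    by (intro filterlim_tendsto_add_at_top[OF tendsto_const] filterlim_tendsto_pos_mult_at_top[OF tendsto_const]) auto
  then show "filterlim (\<lambda>n. s n / 2 - 1) at_top sequentially" by simp
  show "eventually (\<lambda>n. s n / 2 - 1 \<le> real (lazy_time (B n) (w n) \<theta> \<epsilon>)) sequentially"
  proof -
    have "eventually (\<lambda>n. \<epsilon>\<^sup>2 < le \<theta> n (nat \<lfloor>(1 - 1/2) * s n\<rfloor>)) sequentially"
      using \<epsilon> by (intro eventually_lazy_cutoff_times(2)[OF cut]) auto
    then show ?thesis
    proof eventually_elim
      case (elim n)
      then have "\<epsilon> < sqrt (le \<theta> n (nat \<lfloor>(1 - 1/2) * s n\<rfloor>))" by (rule real_less_rsqrt)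
      then have "nat \<lfloor>(1 - 1/2) * s n\<rfloor> < lazy_time (B n) (w n) \<theta> \<epsilon>"
        by (rule spectral.lazy_time_gt[OF sp \<theta> \<epsilon>])
      moreover have "(1 - 1/2) * s n = s n / 2" by simp
      ultimately show ?case by linarith
    qed
  qed
qed

text \<open>The comparisons of mixing times divided by the lazy time; the additive error 2
  disappears because the lazy time diverges.\<close>

lemma time_ratio_bounds:
  assumes \<theta>: "1/2 < \<theta>" "\<theta> < 1" and \<epsilon>: "0 < \<epsilon>"
    and top: "filterlim (\<lambda>n. real (lazy_time (B n) (w n) \<theta> \<epsilon>)) at_top sequentially"
  shows "ereal (1 - \<theta>) \<le> Liminf sequentially (\<lambda>n. ereal (cont_time (B n) (w n) \<epsilon> / real (lazy_time (B n) (w n) \<theta> \<epsilon>)))"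
    and "Limsup sequentially (\<lambda>n. ereal (cont_time (B n) (w n) \<epsilon> / real (lazy_time (B n) (w n) \<theta> \<epsilon>))) \<le> ereal (- ln (2 * \<theta> - 1) / 2)"
proof -
  let ?T = "\<lambda>n. real (lazy_time (B n) (w n) \<theta> \<epsilon>)" and ?C = "\<lambda>n. cont_time (B n) (w n) \<epsilon>"
  have pos: "eventually (\<lambda>n. 0 < ?T n) sequentially" using top unfolding filterlim_at_top_dense by blast
  have "(\<lambda>n. (1 - \<theta>) - 2 / ?T n) \<longlonglongrightarrow> (1 - \<theta>) - 0"
    by (intro tendsto_diff tendsto_const tendsto_divide_0[OF tendsto_const] filterlim_at_top_imp_at_infinity top)
  then have "(\<lambda>n. ereal ((1 - \<theta>) - 2 / ?T n)) \<longlonglongrightarrow> ereal (1 - \<theta>)" by simp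
  then have "ereal (1 - \<theta>) = Liminf sequentially (\<lambda>n. ereal ((1 - \<theta>) - 2 / ?T n))"
    by (intro lim_imp_Liminf[symmetric]) auto
  also have "\<dots> \<le> Liminf sequentially (\<lambda>n. ereal (?C n / ?T n))"
  proof (rule Liminf_mono)
    show "eventually (\<lambda>n. ereal ((1 - \<theta>) - 2 / ?T n) \<le> ereal (?C n / ?T n)) sequentially"
      using pos
    proof eventually_elim
      case (elim n)
      have "(1 - \<theta>) - 2 / ?T n = ((1 - \<theta>) * ?T n - 2) / ?T n" using elim by (simp add: diff_divide_distrib)
      also have "\<dots> \<le> ?C n / ?T n"
        using spectral.lazy_time_le_cont_time[OF sp, of \<theta> \<epsilon> n] \<theta> \<epsilon> by (intro divide_right_mono) auto
      finally show ?case by simp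
    qed
  qed
  finally show "ereal (1 - \<theta>) \<le> Liminf sequentially (\<lambda>n. ereal (?C n / ?T n))" .
  show "Limsup sequentially (\<lambda>n. ereal (?C n / ?T n)) \<le> ereal (- ln (2 * \<theta> - 1) / 2)"
  proof (rule Limsup_bounded)
    show "eventually (\<lambda>n. ereal (?C n / ?T n) \<le> ereal (- ln (2 * \<theta> - 1) / 2)) sequentially"
      using pos
    proof eventually_elim
      case (elim n)
      then show ?case using spectral.cont_time_le_lazy_time[OF sp \<theta> \<epsilon>, of n] by (simp add: field_simps)
    qed
  qed
qed

end

section \<open>From spectral measures back to the chains\<close>

theorem theorem3p5:
  fixes S :: "nat \<Rightarrow> 'a set" and K :: "nat \<Rightarrow> 'a \<Rightarrow> 'a \<Rightarrow> real"
    and \<pi> \<mu> :: "nat \<Rightarrow> 'a \<Rightarrow> real"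
  assumes chain: "\<And>n. markov_chain (S n) (K n)"
    and irr: "\<And>n. irreducible_chain (S n) (K n)"
    and rev: "\<And>n. reversible_chain (S n) (K n) (\<pi> n)"
    and init: "\<And>n. prob_dist (S n) (\<mu> n)"
    and big: "filterlim (\<lambda>n. \<Sum>y\<in>S n. (\<mu> n y)\<^sup>2 / \<pi> n y) at_top sequentially"
  shows
    "(\<forall>\<theta>. 1/2 \<le> \<theta> \<and> \<theta> < 1 \<longrightarrow>
        cutoff_disc S (\<lambda>n. lazy_kernel \<theta> (K n)) \<pi> \<mu> \<and>
        (\<exists>\<epsilon>0>0. filterlim (\<lambda>n. T2_disc (S n) (lazy_kernel \<theta> (K n)) (\<pi> n) (\<mu> n) \<epsilon>0) at_top sequentially)
        \<longrightarrow> cutoff_cont S K \<pi> \<mu>)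
   \<and> (cutoff_cont S K \<pi> \<mu> \<and>
        (\<exists>\<epsilon>0>0. filterlim (\<lambda>n. T2_cont (S n) (K n) (\<pi> n) (\<mu> n) \<epsilon>0) at_top sequentially)
        \<longrightarrow> (\<forall>\<theta>. 1/2 < \<theta> \<and> \<theta> < 1 \<longrightarrow> cutoff_disc S (\<lambda>n. lazy_kernel \<theta> (K n)) \<pi> \<mu>))
   \<and> (\<forall>\<theta>. 1/2 < \<theta> \<and> \<theta> < 1 \<longrightarrow>
        cutoff_cont S K \<pi> \<mu> \<and> cutoff_disc S (\<lambda>n. lazy_kernel \<theta> (K n)) \<pi> \<mu> \<and>
        (\<exists>\<epsilon>0>0. filterlim (\<lambda>n. T2_cont (S n) (K n) (\<pi> n) (\<mu> n) \<epsilon>0) at_top sequentially \<or>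
                 filterlim (\<lambda>n. T2_disc (S n) (lazy_kernel \<theta> (K n)) (\<pi> n) (\<mu> n) \<epsilon>0) at_top sequentially)
        \<longrightarrow> (\<forall>\<epsilon>>0.
              ereal (1 - \<theta>) \<le> Liminf sequentially (\<lambda>n. ereal (T2_cont (S n) (K n) (\<pi> n) (\<mu> n) \<epsilon> /
                   real (T2_disc (S n) (lazy_kernel \<theta> (K n)) (\<pi> n) (\<mu> n) \<epsilon>))) \<and>
              Liminf sequentially (\<lambda>n. ereal (T2_cont (S n) (K n) (\<pi> n) (\<mu> n) \<epsilon> /
                   real (T2_disc (S n) (lazy_kernel \<theta> (K n)) (\<pi> n) (\<mu> n) \<epsilon>))) \<le>
              Limsup sequentially (\<lambda>n. ereal (T2_cont (S n) (K n) (\<pi> n) (\<mu> n) \<epsilon> /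
                   real (T2_disc (S n) (lazy_kernel \<theta> (K n)) (\<pi> n) (\<mu> n) \<epsilon>))) \<and>
              Limsup sequentially (\<lambda>n. ereal (T2_cont (S n) (K n) (\<pi> n) (\<mu> n) \<epsilon> /
                   real (T2_disc (S n) (lazy_kernel \<theta> (K n)) (\<pi> n) (\<mu> n) \<epsilon>))) \<le>
              ereal (- ln (2 * \<theta> - 1) / 2)))"
proof -
  \<comment> \<open>Weights and support are paired so that a single choice per \<open>n\<close>
    yields one measure describing the continuous chain and the lazy chains for all \<theta> at
    once.\<close>
  define P where "P = (\<lambda>n Bw. spectral (fst Bw) (snd Bw) \<and>
      (\<forall>\<theta> m. d2_disc (S n) (lazy_kernel \<theta> (K n)) (\<pi> n) (\<mu> n) m = sqrt (lazy_energy (fst Bw) (snd Bw) \<theta> m)) \<and>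
      (\<forall>t. d2_cont (S n) (K n) (\<pi> n) (\<mu> n) t = sqrt (cont_energy (fst Bw) (snd Bw) t)) \<and>
      cont_energy (fst Bw) (snd Bw) 0 = (\<Sum>y\<in>S n. (\<mu> n y)\<^sup>2 / \<pi> n y) - 1)"
  have "\<exists>Bw. P n Bw" for n
  proof (rule spectral_measure[OF chain[of n] irr[of n] rev[of n] init[of n]])
    fix B :: "real set" and w :: "real \<Rightarrow> real"
    assume "finite B" "\<And>l. l \<in> B \<Longrightarrow> 0 < l \<and> l \<le> 2 \<and> 0 \<le> w l"
    then have "spectral B w" by (rule spectral.intro)
    moreover assume "\<And>\<theta> m. d2_disc (S n) (lazy_kernel \<theta> (K n)) (\<pi> n) (\<mu> n) m = sqrt (\<Sum>l\<in>B. w l * (1 - (1 - \<theta>) * l) ^ (2 * m))"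
      "\<And>t. d2_cont (S n) (K n) (\<pi> n) (\<mu> n) t = sqrt (\<Sum>l\<in>B. w l * exp (- (2 * t * l)))"
      "(\<Sum>l\<in>B. w l) = (\<Sum>y\<in>S n. (\<mu> n y)\<^sup>2 / \<pi> n y) - 1"
    ultimately have "P n (B, w)" by (simp add: P_def cont_energy_def lazy_energy_def)
    then show ?thesis by (rule exI)
  qed
  then obtain Bw where Bw: "\<And>n. P n (Bw n)" by metis
  define B where "B = (\<lambda>n. fst (Bw n))"
  define w where "w = (\<lambda>n. snd (Bw n))"
  have Bw: "spectral (B n) (w n)"
    "d2_disc (S n) (lazy_kernel \<theta> (K n)) (\<pi> n) (\<mu> n) m = sqrt (lazy_energy (B n) (w n) \<theta> m)"
    "d2_cont (S n) (K n) (\<pi> n) (\<mu> n) t = sqrt (cont_energy (B n) (w n) t)"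
    "cont_energy (B n) (w n) 0 = (\<Sum>y\<in>S n. (\<mu> n y)\<^sup>2 / \<pi> n y) - 1" for n \<theta> m t
    using Bw[of n] by (simp_all add: P_def B_def w_def)
  interpret spectral_family B w
  proof (rule spectral_family.intro)
    show "filterlim (\<lambda>n. cont_energy (B n) (w n) 0) at_top sequentially"
      using filterlim_tendsto_add_at_top[OF tendsto_const big, of "-1"] by (simp add: Bw(4))
  qed (rule Bw(1))
  have times: "T2_cont (S n) (K n) (\<pi> n) (\<mu> n) \<epsilon> = cont_time (B n) (w n) \<epsilon>"
    "T2_disc (S n) (lazy_kernel \<theta> (K n)) (\<pi> n) (\<mu> n) \<epsilon> = lazy_time (B n) (w n) \<theta> \<epsilon>" for n \<epsilon> \<theta>
    by (simp_all add: T2_cont_def T2_disc_def cont_time_def lazy_time_def Bw(2,3))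
  have cc: "cutoff_cont S K \<pi> \<mu> \<longleftrightarrow> (\<exists>t. cont_cutoff_times t)"
    unfolding cutoff_cont_def cont_cutoff_times_def Bw(3)
    by (simp add: sqrt_tendsto_0_iff sqrt_at_top_iff spectral.cont_energy_nonneg[OF sp])
  have cd: "cutoff_disc S (\<lambda>n. lazy_kernel \<theta> (K n)) \<pi> \<mu> \<longleftrightarrow> (\<exists>s. lazy_cutoff_times \<theta> s)" for \<theta>
    unfolding cutoff_disc_def lazy_cutoff_times_def Bw(2)
    by (simp add: sqrt_tendsto_0_iff sqrt_at_top_iff spectral.lazy_energy_nonneg[OF sp])
  show ?thesis
    unfolding times cc cd
  proof (intro conjI allI impI)
    fix \<theta> :: real
    assume \<theta>: "1/2 \<le> \<theta> \<and> \<theta> < 1"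
      and h: "(\<exists>s. lazy_cutoff_times \<theta> s) \<and> (\<exists>\<epsilon>0>0. filterlim (\<lambda>n. lazy_time (B n) (w n) \<theta> \<epsilon>0) at_top sequentially)"
    then obtain s \<epsilon>0 where s: "lazy_cutoff_times \<theta> s" "0 < \<epsilon>0" "filterlim (\<lambda>n. lazy_time (B n) (w n) \<theta> \<epsilon>0) at_top sequentially"
      by blast
    show "\<exists>t. cont_cutoff_times t"
      using cont_cutoff_of_lazy_cutoff[OF _ _ s(1) lazy_cutoff_times_at_top[OF s]] \<theta> by blast
  next
    fix \<theta> :: real
    assume \<theta>: "1/2 < \<theta> \<and> \<theta> < 1"
      and h: "(\<exists>t. cont_cutoff_times t) \<and> (\<exists>\<epsilon>0>0. filterlim (\<lambda>n. cont_time (B n) (w n) \<epsilon>0) at_top sequentially)"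
    then obtain t \<epsilon>0 where t: "cont_cutoff_times t" "0 < \<epsilon>0" "filterlim (\<lambda>n. cont_time (B n) (w n) \<epsilon>0) at_top sequentially"
      by blast
    show "\<exists>s. lazy_cutoff_times \<theta> s"
      using lazy_cutoff_of_cont_cutoff[OF _ _ t(1) cont_cutoff_times_at_top[OF t]] \<theta> by blast
  next
    fix \<theta> \<epsilon> :: real
    let ?r = "\<lambda>n. ereal (cont_time (B n) (w n) \<epsilon> / real (lazy_time (B n) (w n) \<theta> \<epsilon>))"
    assume \<theta>: "1/2 < \<theta> \<and> \<theta> < 1" and \<epsilon>: "0 < \<epsilon>"
      and h: "(\<exists>t. cont_cutoff_times t) \<and> (\<exists>s. lazy_cutoff_times \<theta> s) \<and>
        (\<exists>\<epsilon>0>0. filterlim (\<lambda>n. cont_time (B n) (w n) \<epsilon>0) at_top sequentially \<or>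
                 filterlim (\<lambda>n. lazy_time (B n) (w n) \<theta> \<epsilon>0) at_top sequentially)"
    then obtain s \<epsilon>0 where s: "lazy_cutoff_times \<theta> s" "0 < \<epsilon>0"
      and or: "filterlim (\<lambda>n. cont_time (B n) (w n) \<epsilon>0) at_top sequentially \<or>
               filterlim (\<lambda>n. lazy_time (B n) (w n) \<theta> \<epsilon>0) at_top sequentially"
      by blast
    define c where "c = - ln (2 * \<theta> - 1) / 2"
    have c: "0 < c" using \<theta> by (simp add: c_def)
    \<comment> \<open>The continuous time is at most \<open>c\<close> times the lazy time at the
      same level, so divergence of the former implies that of the latter and both alternatives
      reduce to the lazy one.\<close>
    have "filterlim (\<lambda>n. lazy_time (B n) (w n) \<theta> \<epsilon>0) at_top sequentially"
      if top: "filterlim (\<lambda>n. cont_time (B n) (w n) \<epsilon>0) at_top sequentially"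
    proof -
      have lim: "filterlim (\<lambda>n. (1 / c) * cont_time (B n) (w n) \<epsilon>0) at_top sequentially"
        using c by (intro filterlim_tendsto_pos_mult_at_top[OF tendsto_const _ top]) auto
      have le: "(1 / c) * cont_time (B n) (w n) \<epsilon>0 \<le> real (lazy_time (B n) (w n) \<theta> \<epsilon>0)" for n
      proof -
        have "cont_time (B n) (w n) \<epsilon>0 \<le> c * lazy_time (B n) (w n) \<theta> \<epsilon>0"
          unfolding c_def using \<theta> s(2) by (intro spectral.cont_time_le_lazy_time[OF sp]) auto
        then show ?thesis using c by (simp add: field_simps)
      qed
      have "filterlim (\<lambda>n. real (lazy_time (B n) (w n) \<theta> \<epsilon>0)) at_top sequentially"
        by (rule filterlim_at_top_mono[OF lim eventuallyI[OF le]])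
      then show ?thesis by (simp add: filterlim_sequentially_iff_filterlim_real)
    qed
    then have lt: "filterlim (\<lambda>n. lazy_time (B n) (w n) \<theta> \<epsilon>0) at_top sequentially" using or by blast
    have "filterlim (\<lambda>n. real (lazy_time (B n) (w n) \<theta> \<epsilon>)) at_top sequentially"
      using lazy_time_at_top[OF _ _ s lt \<epsilon>] \<theta> by simp
    then show "ereal (1 - \<theta>) \<le> Liminf sequentially ?r" "Limsup sequentially ?r \<le> ereal (- ln (2 * \<theta> - 1) / 2)"
      using time_ratio_bounds[OF _ _ \<epsilon>] \<theta> by auto
    show "Liminf sequentially ?r \<le> Limsup sequentially ?r" by (intro Liminf_le_Limsup) simp
  qed
qed

end
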